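(* Let $X_1,X_2,\dots$ be i.i.d. random variables, let $U_n=U_n(X_1,\dots,X_n)$, $n\ge1$, be statistics (measurable functions), and suppose there is $\vartheta\in\mathbb R$ with $\mathsf P\big(\sqrt n(U_n-\vartheta)<x\big)\Longrightarrow\Phi(x)$ as $n\to\infty$. For each $n\in\mathbb N$ let $N_{r,\alpha,1/n^{\alpha}}$ have the generalized negative binomial distribution with parameters $r,\alpha,\mu=n^{-\alpha}$, independent of $X_1,X_2,\dots$, and let $U_{N}$ denote the statistic evaluated at the random sample $X_1,\dots,X_N$. (i) Let $r>0$, $\alpha\in\mathbb R\setminus\{0\}$. Then, as $n\to\infty$, $$\sqrt n\big(U_{N_{r,\alpha,1/n^{\alpha}}}-\vartheta\big)\Longrightarrow X\cdot\sqrt{G^*_{r,-\alpha,1}},$$ with $X$ and $G^*_{r,-\alpha,1}$ independent. (ii) If, in addition, $r\in(0,1]$ and $\alpha\in(0,1]$, then the limit law can be represented as $$X\sqrt{G^*_{r,-\alpha,1}}\stackrel{d}{=}X\sqrt{\frac{S_{\alpha,1}Z_{r,1}^{1/\alpha}}{W_1}}\stackrel{d}{=}S_{2\alpha,0}\sqrt{\frac{Z_{r,1}^{1/\alpha}}{2W_1}},$$ where in each term the factors are independent.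
   Context: $\Phi$ is the standard normal distribution function and $X$ a standard normal random variable; $U_0$ is an arbitrary fixed constant. The generalized gamma density is $g^*(x;r,\alpha,\lambda)=\frac{|\alpha|\lambda^r}{\Gamma(r)}x^{\alpha r-1}e^{-\lambda x^{\alpha}}$, $x\ge0$ ($r,\lambda>0$, $\alpha\ne0$), $G^*_{r,\alpha,\lambda}$ a random variable with this density. $N_{r,\alpha,\mu}$ has the generalized negative binomial distribution $\mathsf P(N_{r,\alpha,\mu}=k)=\frac1{k!}\int_0^\infty e^{-z}z^kg^*(z;r,\alpha,\mu)dz$, $k\ge0$. $W_1$ is standard exponential. $G_{s,1}$ is gamma with density $\frac1{\Gamma(s)}x^{s-1}e^{-x}$ ($s>0$), $G_{0,1}:=0$. For $0<\alpha\le1$, $S_{\alpha,1}$ has characteristic function $\exp\{-|t|^{\alpha}\exp(-\tfrac12 i\pi\alpha\,\mathrm{sign}\,t)\}$ (degenerate at $1$ if $\alpha=1$); $S_{2\alpha,0}$ has characteristic function $e^{-|t|^{2\alpha}}$. $Z_{r,1}=(G_{r,1}+G_{1-r,1})/G_{r,1}$ with independent gamma factors. *)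

theory Defs
  imports "HOL-Probability.Probability"
begin

definition gen_gamma_density :: "real \<Rightarrow> real \<Rightarrow> real \<Rightarrow> real \<Rightarrow> real" where
  "gen_gamma_density r \<alpha> lam x =
     (if 0 < x then \<bar>\<alpha>\<bar> * lam powr r / Gamma r * x powr (\<alpha> * r - 1) * exp (- lam * x powr \<alpha>)
      else 0)"

definition gen_gamma_distr :: "real \<Rightarrow> real \<Rightarrow> real \<Rightarrow> real measure" where
  "gen_gamma_distr r \<alpha> lam = density lborel (gen_gamma_density r \<alpha> lam)"

definition gen_negbin_prob :: "real \<Rightarrow> real \<Rightarrow> real \<Rightarrow> nat \<Rightarrow> real" where
  "gen_negbin_prob r \<alpha> \<mu> k =
     (1 / fact k) * (LINT z|lborel. exp (- z) * z ^ k * gen_gamma_density r \<alpha> \<mu> z)"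

definition gamma_distr :: "real \<Rightarrow> real measure" where
  "gamma_distr s = (if s = 0 then return borel 0
     else density lborel (\<lambda>x. if 0 < x then x powr (s - 1) * exp (- x) / Gamma s else 0))"

definition Z_distr :: "real \<Rightarrow> real measure" where
  "Z_distr r = distr (gamma_distr r \<Otimes>\<^sub>M gamma_distr (1 - r)) borel (\<lambda>(g, h). (g + h) / g)"

definition exp1_distr :: "real measure" where
  "exp1_distr = density lborel (exponential_density 1)"

definition stable_os_char :: "real \<Rightarrow> real \<Rightarrow> complex" where
  "stable_os_char \<alpha> t = exp (- complex_of_real (\<bar>t\<bar> powr \<alpha>) * cis (- pi * \<alpha> * sgn t / 2))"

definition stable_sym_char :: "real \<Rightarrow> real \<Rightarrow> complex" where
  "stable_sym_char \<alpha> t = complex_of_real (exp (- (\<bar>t\<bar> powr (2 * \<alpha>))))"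

end

theory Submission
  imports Defs "HOL-Real_Asymp.Real_Asymp"
begin

text \<open>
  (i) A generalized negative binomial \<open>N\<^sub>n\<close> is Poisson with random mean \<open>n V\<close>, where
  \<open>V = G\<^bsup>1/\<alpha>\<^esup>\<close> and \<open>G\<close> is gamma distributed with shape \<open>r\<close>; hence \<open>N\<^sub>n / n\<close> converges weakly to \<open>V\<close>.
  By independence the characteristic function of \<open>\<surd>n (U\<^sub>N - \<theta>)\<close> at \<open>t\<close> is the mean over \<open>N\<close> of the
  characteristic function of \<open>\<surd>k (U\<^sub>k - \<theta>)\<close> at \<open>t / \<surd>(k/n)\<close>, \<open>k = N\<^sub>n\<close>. Weak convergence makes the
  latter converge continuously to \<open>exp (-t\<^sup>2/2)\<close>, and after passing to a Skorohod representation of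
  \<open>N\<^sub>n / n\<close> dominated convergence yields the mean of \<open>exp (-t\<^sup>2/(2 V))\<close>.

  (ii) All three laws have the characteristic function \<open>E exp (-(t\<^sup>2/(2 W))\<^bsup>\<alpha>\<^esup> Z)\<close>. This rests on
  \<open>E exp (-u Z) = P(G \<ge> u)\<close> and on the Laplace transform \<open>exp (-s\<^bsup>\<alpha>\<^esup>)\<close> of the one-sided stable law.
  The latter is recovered from the characteristic function without analytic continuation: the
  Sibuya law on the positive integers has generating function \<open>1 - (1 - z)\<^bsup>\<alpha>\<^esup>\<close> on the whole closed unit
  disc, and its \<open>n\<close>-fold convolutions, scaled by \<open>n\<^bsup>-1/\<alpha>\<^esup>\<close>, have both the right characteristic
  functions and the right Laplace transforms in the limit.
\<close>

section \<open>Gamma laws\<close>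

lemma measurable_gen_gamma_density [measurable]: "gen_gamma_density r a l \<in> borel_measurable borel"
  unfolding gen_gamma_density_def[abs_def] by measurable

lemma gen_gamma_density_nonneg: "0 < r \<Longrightarrow> 0 \<le> gen_gamma_density r a l x"
  using Gamma_real_pos[of r] by (simp add: gen_gamma_density_def)

lemma sets_gamma_distr [simp, measurable_cong]: "sets (gamma_distr s) = sets borel"
  by (simp add: gamma_distr_def)

lemma space_gamma_distr [simp]: "space (gamma_distr s) = UNIV"
  by (simp add: gamma_distr_def)

text \<open>Substituting t = c x in Euler's integral. The case c = 1 gives total mass one, the case
  c = 1 + u the Laplace transform; the nonnegative integral delivers both without a separate
  integrability proof.\<close>

lemma nn_integral_gamma_kernel:
  fixes s c :: real
  assumes "0 < s" "0 < c"
  shows "(\<integral>\<^sup>+x. ennreal (if 0 < x then x powr (s - 1) * exp (- c * x) / Gamma s else 0) \<partial>lborel)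
    = ennreal (c powr (- s))"
proof -
  let ?f = "\<lambda>t. ennreal (indicator {0..} t * t powr (s - 1) / exp t)"
  have pos: "0 < Gamma s" using assms by (simp add: Gamma_real_pos)
  have "ennreal (Gamma s) = (\<integral>\<^sup>+t. ?f t \<partial>lborel)"
    using Gamma_conv_nn_integral_real[OF assms(1)] .
  also have "\<dots> = ennreal \<bar>c\<bar> * (\<integral>\<^sup>+x. ?f (0 + c * x) \<partial>lborel)"
    using assms by (intro nn_integral_real_affine) auto
  also have "\<dots> = (\<integral>\<^sup>+x. ennreal \<bar>c\<bar> * ?f (0 + c * x) \<partial>lborel)"
    by (subst nn_integral_cmult) auto
  also have "\<dots> = (\<integral>\<^sup>+x. ennreal (c powr s * Gamma s) *
      ennreal (if 0 < x then x powr (s - 1) * exp (- c * x) / Gamma s else 0) \<partial>lborel)"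
  proof (rule nn_integral_cong_AE, use AE_lborel_singleton[of 0] in eventually_elim)
    fix x :: real assume "x \<noteq> 0"
    show "ennreal \<bar>c\<bar> * ?f (0 + c * x) = ennreal (c powr s * Gamma s) *
      ennreal (if 0 < x then x powr (s - 1) * exp (- c * x) / Gamma s else 0)"
    proof (cases "0 < x")
      case True
      have "c * (c * x) powr (s - 1) = c * c powr (s - 1) * x powr (s - 1)"
        using assms True by (simp add: powr_mult)
      also have "c * c powr (s - 1) = c powr s"
        using assms by (simp add: powr_diff)
      finally have "c * ((c * x) powr (s - 1) / exp (c * x)) = c powr s * x powr (s - 1) * exp (- c * x)"
        by (simp add: exp_minus divide_inverse)
      also have "\<dots> = c powr s * Gamma s * (x powr (s - 1) * exp (- c * x) / Gamma s)"
        using pos by simp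
      finally have "ennreal (c * ((c * x) powr (s - 1) / exp (c * x)))
        = ennreal (c powr s * Gamma s * (x powr (s - 1) * exp (- c * x) / Gamma s))" by (rule arg_cong)
      moreover have "ennreal \<bar>c\<bar> * ?f (0 + c * x) = ennreal (c * ((c * x) powr (s - 1) / exp (c * x)))"
        using True assms by (subst ennreal_mult'[symmetric]) auto
      moreover have "ennreal (c powr s * Gamma s * (x powr (s - 1) * exp (- c * x) / Gamma s))
        = ennreal (c powr s * Gamma s) * ennreal (if 0 < x then x powr (s - 1) * exp (- c * x) / Gamma s else 0)"
        using True assms pos by (subst ennreal_mult'[symmetric]) auto
      ultimately show ?thesis by simp
    next
      case False
      then show ?thesis using \<open>x \<noteq> 0\<close> assms by (simp add: indicator_def zero_le_mult_iff)
    qed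
  qed
  also have "\<dots> = ennreal (c powr s * Gamma s) *
      (\<integral>\<^sup>+x. ennreal (if 0 < x then x powr (s - 1) * exp (- c * x) / Gamma s else 0) \<partial>lborel)" (is "_ = _ * ?I")
    by (subst nn_integral_cmult) auto
  finally have eq: "ennreal (Gamma s) = ennreal (c powr s * Gamma s) * ?I" .
  have "ennreal (c powr (- s)) = ennreal (c powr (- s) / Gamma s) * ennreal (Gamma s)"
    using pos by (simp add: ennreal_mult'[symmetric])
  also have "\<dots> = ennreal (c powr (- s) / Gamma s) * ennreal (c powr s * Gamma s) * ?I"
    by (subst eq) (simp add: mult.assoc)
  also have "ennreal (c powr (- s) / Gamma s) * ennreal (c powr s * Gamma s) = 1"
    using less_imp_neq[OF pos] assms by (subst ennreal_mult'[symmetric]) (auto simp: powr_minus)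
  finally show ?thesis by simp
qed

lemma prob_space_gamma_distr:
  assumes "0 \<le> s" shows "prob_space (gamma_distr s)"
proof (cases "s = 0")
  case True then show ?thesis by (simp add: gamma_distr_def prob_space_return)
next
  case False
  then show ?thesis
    using nn_integral_gamma_kernel[of s 1] assms
    by (intro prob_spaceI) (simp add: gamma_distr_def emeasure_density cong: if_cong)
qed

lemma AE_gamma_distr_pos:
  assumes "0 < s" shows "AE x in gamma_distr s. 0 < x"
proof -
  have "AE x in density lborel (\<lambda>x. ennreal (if 0 < x then x powr (s - 1) * exp (- x) / Gamma s else 0)). 0 < x"
    by (subst AE_density) auto
  then show ?thesis using assms unfolding gamma_distr_def by simp
qed

lemma integral_gamma_distr:
  fixes f :: "real \<Rightarrow> 'b::{banach, second_countable_topology}"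
  assumes s: "0 < s" and [measurable]: "f \<in> borel_measurable borel"
  shows "(LINT x|gamma_distr s. f x)
    = (LINT x|lborel. (if 0 < x then x powr (s - 1) * exp (- x) / Gamma s else 0) *\<^sub>R f x)"
  using s Gamma_real_pos[OF s]
  by (simp add: gamma_distr_def integral_density)

text \<open>Multiplying the density by \<open>exp (- (u * x))\<close> turns its rate 1 into 1 + u.
  The degenerate case s = 0, with constant transform 1, is included because the shape 1 - r vanishes
  at r = 1.\<close>

lemma gamma_distr_laplace:
  assumes s: "0 \<le> s" and u: "0 \<le> u"
  shows "(LINT x|gamma_distr s. exp (- (u * x))) = (1 + u) powr (- s)"
proof (cases "s = 0")
  case True then show ?thesis using u by (simp add: gamma_distr_def integral_return)
next
  case False
  with s have s: "0 < s" by simp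
  have "(LINT x|gamma_distr s. exp (- (u * x)))
    = (LINT x|lborel. (if 0 < x then x powr (s - 1) * exp (- (1 + u) * x) / Gamma s else 0))"
    using s by (subst integral_gamma_distr) (auto intro!: Bochner_Integration.integral_cong simp: algebra_simps exp_add[symmetric])
  also have "\<dots> = enn2real (\<integral>\<^sup>+x. ennreal (if 0 < x then x powr (s - 1) * exp (- (1 + u) * x) / Gamma s else 0) \<partial>lborel)"
    using Gamma_real_pos[OF s] by (intro integral_eq_nn_integral) auto
  also have "\<dots> = (1 + u) powr (- s)"
    using s u by (subst nn_integral_gamma_kernel) auto
  finally show ?thesis .
qed

lemma AE_gamma_distr_nonneg:
  assumes "0 \<le> s" shows "AE x in gamma_distr s. 0 \<le> x"
proof (cases "s = 0")
  case True
  have "AE h in return borel (0::real). 0 \<le> h" by (subst AE_return) auto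
  then show ?thesis using True unfolding gamma_distr_def by simp
next
  case False
  then show ?thesis using assms AE_gamma_distr_pos[of s] by auto
qed

text \<open>The second coordinate can only be claimed nonnegative: at r = 1 it is the point mass at
  0. Positivity of the first keeps the quotient in \<open>Z_distr\<close> genuine up to a null
  set.\<close>

lemma AE_gamma_pair:
  assumes r: "0 < r" "r \<le> 1"
  shows "AE p in gamma_distr r \<Otimes>\<^sub>M gamma_distr (1 - r). 0 < fst p \<and> 0 \<le> snd p"
proof -
  interpret G: prob_space "gamma_distr r" using r by (intro prob_space_gamma_distr) auto
  interpret H: prob_space "gamma_distr (1 - r)" using r by (intro prob_space_gamma_distr) auto
  interpret pair_prob_space "gamma_distr r" "gamma_distr (1 - r)" ..
  show ?thesis
  proof (rule AE_pair_measure)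
    show "AE x in gamma_distr r. AE y in gamma_distr (1 - r). 0 < fst (x, y) \<and> 0 \<le> snd (x, y)"
      using AE_gamma_distr_pos[OF r(1)]
      by eventually_elim (use AE_gamma_distr_nonneg[of "1 - r"] r in auto)
  qed measurable
qed

section \<open>The ratio law Z and its Laplace transform\<close>

lemma sets_Z_distr [simp, measurable_cong]: "sets (Z_distr r) = sets borel"
  by (simp add: Z_distr_def)

lemma prob_space_Z_distr:
  assumes "0 < r" "r \<le> 1" shows "prob_space (Z_distr r)"
proof -
  interpret G: prob_space "gamma_distr r" using assms by (intro prob_space_gamma_distr) auto
  interpret H: prob_space "gamma_distr (1 - r)" using assms by (intro prob_space_gamma_distr) auto
  interpret pair_prob_space "gamma_distr r" "gamma_distr (1 - r)" ..
  show ?thesis unfolding Z_distr_def by (intro prob_space_distr) measurable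
qed

lemma AE_Z_distr_nonneg:
  assumes r: "0 < r" "r \<le> 1" shows "AE z in Z_distr r. 0 \<le> z"
  unfolding Z_distr_def
proof (subst AE_distr_iff)
  show "AE p in gamma_distr r \<Otimes>\<^sub>M gamma_distr (1 - r). 0 \<le> (case p of (g, h) \<Rightarrow> (g + h) / g)"
    using AE_gamma_pair[OF r] by eventually_elim auto
qed measurable

text \<open>Given G = g, the exponent u (g + h) / g splits as u + (u / g) h, and integrating out h
  leaves exp (-u) (1 + u / g)^(r - 1). Against the density g^(r - 1) exp (-g) / Gamma r this becomes
  the same density at u + g, so a shift turns the integral into the gamma tail beyond u.\<close>

lemma Z_distr_laplace:
  assumes r: "0 < r" "r \<le> 1" and u: "0 \<le> u"
  shows "(LINT z|Z_distr r. exp (- (u * z))) = measure (gamma_distr r) {u..}"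
proof -
  let ?G = "gamma_distr r" and ?H = "gamma_distr (1 - r)"
  interpret G: prob_space ?G using r by (intro prob_space_gamma_distr) auto
  interpret H: prob_space ?H using r by (intro prob_space_gamma_distr) auto
  interpret pair_prob_space ?G ?H ..
  have int: "integrable (?G \<Otimes>\<^sub>M ?H) (\<lambda>(g, h). exp (- (u * ((g + h) / g))))"
  proof (rule integrable_const_bound[of _ 1])
    show "AE p in ?G \<Otimes>\<^sub>M ?H. norm (case p of (g, h) \<Rightarrow> exp (- (u * ((g + h) / g)))) \<le> 1"
      using AE_gamma_pair[OF r] by eventually_elim (use u in \<open>auto simp: split_beta' intro!: divide_nonneg_pos mult_nonneg_nonneg\<close>)
  qed measurable
  have "(LINT z|Z_distr r. exp (- (u * z)))
    = (LINT p|(?G \<Otimes>\<^sub>M ?H). (\<lambda>(g, h). exp (- (u * ((g + h) / g)))) p)"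
    unfolding Z_distr_def by (subst integral_distr) (auto simp: split_beta')
  also have "\<dots> = (LINT g|?G. (LINT h|?H. exp (- (u * ((g + h) / g)))))"
    using integral_fst'[OF int] by simp
  also have "\<dots> = (LINT g|?G. exp (- u) * (1 + u / g) powr (r - 1))"
  proof (rule integral_cong_AE)
    show "AE g in ?G. (LINT h|?H. exp (- (u * ((g + h) / g)))) = exp (- u) * (1 + u / g) powr (r - 1)"
      using AE_gamma_distr_pos[OF r(1)]
    proof eventually_elim
      case (elim g)
      have "exp (- (u * ((g + h) / g))) = exp (- u) * exp (- (u / g * h))" for h
        using elim by (simp add: exp_add[symmetric] field_simps)
      then show ?case
        using gamma_distr_laplace[of "1 - r" "u / g"] r u elim by simp
    qed
  qed measurable
  also have "\<dots> = (LINT g|lborel. (if 0 < g then (u + g) powr (r - 1) * exp (- (u + g)) / Gamma r else 0))"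
  proof (subst integral_gamma_distr[OF r(1)], goal_cases)
    case 2
    show ?case
    proof (intro Bochner_Integration.integral_cong refl)
      fix g :: real
      have "g powr (r - 1) * (1 + u / g) powr (r - 1) = (u + g) powr (r - 1)" if "0 < g"
      proof -
        have "g powr (r - 1) * (1 + u / g) powr (r - 1) = (g * (1 + u / g)) powr (r - 1)"
          using that u by (simp add: powr_mult)
        also have "g * (1 + u / g) = u + g" using that by (simp add: field_simps)
        finally show ?thesis .
      qed
      then show "(if 0 < g then g powr (r - 1) * exp (- g) / Gamma r else 0) *\<^sub>R (exp (- u) * (1 + u / g) powr (r - 1))
        = (if 0 < g then (u + g) powr (r - 1) * exp (- (u + g)) / Gamma r else 0)"
        by (simp add: exp_diff exp_minus exp_add field_simps)
    qed
  qed simp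
  also have "\<dots> = (LINT y|lborel. (if u < y then y powr (r - 1) * exp (- y) / Gamma r else 0))"
    by (subst (2) lborel_integral_real_affine[where c=1 and t=u]) (auto intro!: Bochner_Integration.integral_cong)
  also have "\<dots> = (LINT y|lborel. (if 0 < y then y powr (r - 1) * exp (- y) / Gamma r else 0) *\<^sub>R indicator {u..} y)"
  proof (rule integral_cong_AE, measurable, use AE_lborel_singleton[of u] in eventually_elim)
    case (elim y)
    then show ?case using u by (auto simp: indicator_def)
  qed
  also have "\<dots> = (LINT y|?G. indicator {u..} y)"
    by (subst integral_gamma_distr[OF r(1)]) auto
  also have "\<dots> = measure ?G {u..}" by simp
  finally show ?thesis .
qed

section \<open>Generalized gamma laws as powers of gamma laws\<close>

text \<open>The substitution y = l x^a carries one density into the other. Change of variables with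
  the absolute value of the derivative covers decreasing maps too, so both signs of a are handled at
  once.\<close>

lemma gen_gamma_distr_eq_distr_gamma:
  assumes r: "0 < r" and a: "a \<noteq> 0" and l: "0 < l"
  shows "gen_gamma_distr r a l = distr (gamma_distr r) borel (\<lambda>x. (x / l) powr (1 / a))"
proof (rule measure_eqI)
  show "sets (gen_gamma_distr r a l) = sets (distr (gamma_distr r) borel (\<lambda>x. (x / l) powr (1 / a)))"
    by (simp add: gen_gamma_distr_def)
next
  fix A assume "A \<in> sets (gen_gamma_distr r a l)"
  then have [measurable]: "A \<in> sets borel" by (simp add: gen_gamma_distr_def)
  interpret G: prob_space "gamma_distr r" using r by (intro prob_space_gamma_distr) auto
  have pos: "0 < Gamma r" using r by (simp add: Gamma_real_pos)
  \<comment> \<open>\<open>f\<close> is the gamma density cut down to the preimage of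
    \<open>A\<close>, and \<open>g\<close> inverts x |-> (x / l)^(1 / a) on the positive
    half-line.\<close>
  define f :: "real \<Rightarrow> real" where
    "f y = (if 0 < y then y powr (r - 1) * exp (- y) / Gamma r else 0) * indicator A ((y / l) powr (1 / a))" for y
  define g where "g x = l * x powr a" for x
  define g' where "g' x = l * (a * x powr (a - 1))" for x
  have [measurable]: "f \<in> borel_measurable borel" unfolding f_def by measurable
  have gS: "g ` {0<..} = {0<..}"
  proof (intro equalityI subsetI)
    fix y :: real assume y: "y \<in> {0<..}"
    have "g ((y / l) powr (1 / a)) = y" "(y / l) powr (1 / a) \<in> {0<..}"
      using y l a by (auto simp: g_def powr_powr)
    then show "y \<in> g ` {0<..}" by (metis image_eqI)
  qed (use l in \<open>auto simp: g_def\<close>)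
  have inj: "inj_on g {0<..}"
  proof (rule inj_onI)
    fix x y :: real assume "x \<in> {0<..}" "y \<in> {0<..}" "g x = g y"
    then have "0 < x" "0 < y" "(x powr a) powr (1 / a) = (y powr a) powr (1 / a)" using l by (auto simp: g_def)
    then show "x = y" using a by (simp add: powr_powr)
  qed
  have key: "\<bar>g' x\<bar> * f (g x) = gen_gamma_density r a l x * indicator A x" if x: "0 < x" for x
  proof -
    have "(g x / l) powr (1 / a) = x" using x l a by (simp add: g_def powr_powr)
    moreover have "\<bar>g' x\<bar> * g x powr (r - 1) = \<bar>a\<bar> * l powr r * x powr (a * r - 1)"
    proof -
      have "\<bar>g' x\<bar> * g x powr (r - 1) = \<bar>a\<bar> * (l * l powr (r - 1)) * (x powr (a - 1) * x powr (a * (r - 1)))"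
        using x l by (simp add: g_def g'_def powr_mult powr_powr abs_mult)
      also have "l * l powr (r - 1) = l powr r" using l by (simp add: powr_diff)
      also have "x powr (a - 1) * x powr (a * (r - 1)) = x powr (a * r - 1)"
        using x by (simp add: powr_add[symmetric] algebra_simps)
      finally show ?thesis .
    qed
    moreover have "0 < g x" using x l by (simp add: g_def)
    ultimately show ?thesis using x
      by (simp add: f_def gen_gamma_density_def indicator_def) (simp add: g_def)
  qed
  have measF: "(LINT y|gamma_distr r. indicator A ((y / l) powr (1 / a))) = (LINT y|lborel. f y)"
    by (subst integral_gamma_distr[OF r]) (auto simp: f_def[abs_def])
  have intf: "integrable lborel f"
  proof -
    have "integrable (gamma_distr r) (\<lambda>y. indicator A ((y / l) powr (1 / a)) :: real)"
      by (rule G.integrable_const_bound[of _ 1]) auto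
    then show ?thesis using r pos
      by (simp add: gamma_distr_def integrable_density f_def[abs_def])
  qed
  \<comment> \<open>The change of variables theorem speaks about absolute integrability for the
    completed measure, so \<open>f\<close> is moved from \<open>lborel\<close> to
    \<open>lebesgue\<close> here and the result is moved back afterwards.\<close>
  have fabs: "f absolutely_integrable_on {0<..}"
    using intf unfolding set_integrable_def
    by (intro integrable_mult_indicator) (auto simp: integrable_completion)
  have fint: "integral {0<..} f = (LINT y|lborel. f y)"
  proof -
    have "integral {0<..} f = (LINT y:{0<..}|lebesgue. f y)"
      using fabs by (rule set_lebesgue_integral_eq_integral(2)[symmetric])
    also have "\<dots> = (LINT y|lebesgue. f y)"
      unfolding set_lebesgue_integral_def
      by (intro Bochner_Integration.integral_cong) (auto simp: f_def)
    also have "\<dots> = (LINT y|lborel. f y)" by (rule integral_completion) auto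
    finally show ?thesis .
  qed
  have "(\<lambda>x. \<bar>g' x\<bar> * f (g x)) absolutely_integrable_on {0<..} \<and>
       integral {0<..} (\<lambda>x. \<bar>g' x\<bar> * f (g x)) = (LINT y|lborel. f y)"
  proof (rule iffD2[OF has_absolute_integral_change_of_variables_1'[where g'=g' and g=g and f=f]])
    show "(g has_real_derivative g' x) (at x within {0<..})" if "x \<in> {0<..}" for x
      unfolding g_def[abs_def] g'_def using that
      by (auto intro!: derivative_eq_intros)
  qed (use inj fabs fint in \<open>auto simp: gS\<close>)
  then have "(\<lambda>x. \<bar>g' x\<bar> * f (g x)) absolutely_integrable_on {0<..}"
     and "integral {0<..} (\<lambda>x. \<bar>g' x\<bar> * f (g x)) = (LINT y|lborel. f y)" by auto
  moreover note set_lebesgue_integral_eq_integral(2)[OF this(1)]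
  ultimately have *: "(LINT x:{0<..}|lebesgue. \<bar>g' x\<bar> * f (g x)) = (LINT y|lborel. f y)" 
    and **: "integrable lebesgue (\<lambda>x. indicator {0<..} x *\<^sub>R (\<bar>g' x\<bar> * f (g x)))"
    by (auto simp: set_integrable_def)
  have eq: "indicator {0<..} x *\<^sub>R (\<bar>g' x\<bar> * f (g x)) = gen_gamma_density r a l x * indicator A x" for x
    using key[of x] by (cases "0 < x") (auto simp: gen_gamma_density_def)
  have I: "integrable lborel (\<lambda>x. gen_gamma_density r a l x * indicator A x)"
    using ** unfolding eq by (subst (asm) integrable_completion) auto
  have E: "(LINT x|lborel. gen_gamma_density r a l x * indicator A x) = (LINT y|lborel. f y)"
    using * unfolding set_lebesgue_integral_def eq by (subst (asm) integral_completion) auto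
  have "emeasure (gen_gamma_distr r a l) A = (\<integral>\<^sup>+x. ennreal (gen_gamma_density r a l x * indicator A x) \<partial>lborel)"
    unfolding gen_gamma_distr_def
    by (subst emeasure_density) (auto intro!: nn_integral_cong simp: indicator_def)
  also have "\<dots> = ennreal (LINT y|lborel. f y)"
    using I gen_gamma_density_nonneg[OF r] by (subst nn_integral_eq_integral) (auto simp: E)
  also have "\<dots> = ennreal (LINT y|gamma_distr r. indicator ((\<lambda>y. (y / l) powr (1 / a)) -` A) y)"
    unfolding measF[symmetric] by (simp add: indicator_def vimage_def)
  also have "\<dots> = emeasure (gamma_distr r) ((\<lambda>y. (y / l) powr (1 / a)) -` A)"
    by (simp add: G.emeasure_eq_measure)
  also have "\<dots> = emeasure (distr (gamma_distr r) borel (\<lambda>x. (x / l) powr (1 / a))) A"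
    by (subst emeasure_distr) auto
  finally show "emeasure (gen_gamma_distr r a l) A = emeasure (distr (gamma_distr r) borel (\<lambda>x. (x / l) powr (1 / a))) A" .
qed

section \<open>The one-sided stable law\<close>

text \<open>Coefficients of the power series of 1 - (1 - z)^\<alpha>. The first summand cancels the
  constant coefficient, so that the weight of 0 vanishes.\<close>

definition sibuya :: "real \<Rightarrow> nat \<Rightarrow> real" where
  "sibuya \<alpha> k = (if k = 0 then 1 else 0) - (\<alpha> gchoose k) * (- 1) ^ k"

text \<open>The recursion starts at index 1, since the weight at 0 is zero while the weight at 1 is
  \<alpha>. Its factor is nonnegative for \<alpha> \<le> 1, so nonnegativity propagates from index
  1.\<close>

lemma sibuya_Suc: "sibuya \<alpha> (Suc (Suc k)) = sibuya \<alpha> (Suc k) * (real (Suc k) - \<alpha>) / real (Suc (Suc k))"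
  by (simp add: sibuya_def gbinomial_prod_rev prod.atLeast0_lessThan_Suc divide_simps) (simp add: algebra_simps)

lemma sibuya_nonneg:
  assumes "0 < \<alpha>" "\<alpha> \<le> 1" shows "0 \<le> sibuya \<alpha> k"
proof (cases k)
  case 0 then show ?thesis by (simp add: sibuya_def)
next
  case (Suc j)
  have "0 \<le> sibuya \<alpha> (Suc j)"
  proof (induction j)
    case 0 then show ?case using assms by (simp add: sibuya_def)
  next
    case (Suc j)
    then show ?case using assms unfolding sibuya_Suc
      by (intro divide_nonneg_nonneg mult_nonneg_nonneg) auto
  qed
  then show ?thesis using Suc by simp
qed

section \<open>The Sibuya generating function on the closed unit disc\<close>

lemma of_real_gbinomial: "complex_of_real (a gchoose k) = complex_of_real a gchoose k"
  by (simp add: gbinomial_prod_rev)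

lemma sibuya_sums_disc:
  fixes z :: complex
  assumes "norm z < 1"
  shows "(\<lambda>k. complex_of_real (sibuya \<alpha> k) * z ^ k) sums (1 - (1 - z) powr \<alpha>)"
proof -
  have "(\<lambda>k. (if k = 0 then 1 else 0) - (complex_of_real \<alpha> gchoose k) * (- z) ^ k) sums (1 - (1 + - z) powr \<alpha>)"
    using assms by (intro sums_diff gen_binomial_complex sums_single[of 0 "\<lambda>_. 1"]) auto
  moreover have "(if k = 0 then 1 else 0) - (complex_of_real \<alpha> gchoose k) * (- z) ^ k
    = complex_of_real (sibuya \<alpha> k) * z ^ k" for k
    using power_minus[of z k] by (simp add: sibuya_def of_real_gbinomial algebra_simps)
  ultimately show ?thesis by simp
qed

text \<open>Abel's argument: for x in [0, 1) the partial sums stay below the series value 1 - (1 -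
  x)^\<alpha>, hence below 1; a finite sum is continuous in x, so the bound survives x -> 1.\<close>

lemma summable_sibuya:
  assumes "0 < \<alpha>" "\<alpha> \<le> 1" shows "summable (sibuya \<alpha>)"
proof (rule summableI_nonneg_bounded)
  fix n
  have "(\<Sum>k<n. sibuya \<alpha> k * x ^ k) \<le> 1" if x: "0 \<le> x" "x < 1" for x
  proof -
    have "(\<lambda>k. complex_of_real (sibuya \<alpha> k * x ^ k)) sums complex_of_real (1 - (1 - x) powr \<alpha>)"
      using sibuya_sums_disc[of "complex_of_real x" \<alpha>] x powr_of_real[of "1 - x" \<alpha>] by simp
    then have s: "(\<lambda>k. sibuya \<alpha> k * x ^ k) sums (1 - (1 - x) powr \<alpha>)"
      by (simp only: sums_of_real_iff)
    have "(\<Sum>k<n. sibuya \<alpha> k * x ^ k) \<le> (1 - (1 - x) powr \<alpha>)"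
      using s sibuya_nonneg[OF assms] x
      by (intro sum_le_suminf[THEN order_trans]) (auto simp: sums_iff)
    then show ?thesis by (smt (verit) powr_ge_zero)
  qed
  then have "\<forall>\<^sub>F x in at_left (1::real). (\<Sum>k<n. sibuya \<alpha> k * x ^ k) \<le> 1"
    using eventually_at_left_real[of 0 1] by (auto elim!: eventually_mono)
  moreover have "((\<lambda>x. \<Sum>k<n. sibuya \<alpha> k * x ^ k) \<longlongrightarrow> (\<Sum>k<n. sibuya \<alpha> k * 1 ^ k)) (at_left (1::real))"
    by (intro tendsto_intros)
  ultimately show "(\<Sum>k<n. sibuya \<alpha> k) \<le> 1"
    by (simp add: tendsto_upperbound)
qed (use sibuya_nonneg assms in auto)

text \<open>The identity extends from the open disc to its boundary along radii: z is replaced by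
  x_m z with x_m -> 1, the series converges by domination with the summable weights, and the closed
  form by continuity.\<close>

lemma sibuya_sums:
  fixes z :: complex
  assumes \<alpha>: "0 < \<alpha>" "\<alpha> \<le> 1" and z: "norm z \<le> 1"
  shows "(\<lambda>k. complex_of_real (sibuya \<alpha> k) * z ^ k) sums (1 - (1 - z) powr \<alpha>)"
proof -
  define x where "x m = 1 - 1 / (real m + 2)" for m
  have x01: "0 \<le> x m" "x m < 1" for m by (auto simp: x_def field_simps)
  have "x \<longlonglongrightarrow> 1" unfolding x_def by real_asymp
  then have xc: "(\<lambda>m. complex_of_real (x m)) \<longlonglongrightarrow> 1" using tendsto_of_real by fastforce
  let ?N = "count_space (UNIV :: nat set)"
  let ?f = "\<lambda>y k. complex_of_real (sibuya \<alpha> k) * (y * z) ^ k"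
  have dom: "integrable ?N (sibuya \<alpha>)"
    using summable_sibuya[OF \<alpha>] sibuya_nonneg[OF \<alpha>] by (simp add: integrable_count_space_nat_iff)
  have bound: "norm (?f y k) \<le> sibuya \<alpha> k" if "norm y \<le> 1" for y k
  proof -
    have "norm (y * z) ^ k \<le> 1" using that z by (intro power_le_one) (auto simp: norm_mult mult_le_one)
    then show ?thesis using sibuya_nonneg[OF \<alpha>, of k]
      by (simp add: norm_mult norm_power mult_left_le)
  qed
  have int: "integrable ?N (?f y)" if "norm y \<le> 1" for y
    using dom by (rule Bochner_Integration.integrable_bound) (use bound[OF that] sibuya_nonneg[OF \<alpha>] in auto)
  have lim1: "(\<lambda>m. LINT k|?N. ?f (x m) k) \<longlonglongrightarrow> (LINT k|?N. ?f 1 k)"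
  proof (rule integral_dominated_convergence[where w="sibuya \<alpha>"])
    show "AE k in ?N. (\<lambda>m. ?f (x m) k) \<longlonglongrightarrow> ?f 1 k"
      by (intro AE_I2 tendsto_intros xc)
    show "AE k in ?N. norm (?f (x m) k) \<le> sibuya \<alpha> k" for m
      using x01[of m] by (intro AE_I2 bound) simp
  qed (use dom in auto)
  have val: "(LINT k|?N. ?f (x m) k) = 1 - (1 - x m * z) powr \<alpha>" for m
  proof -
    have "norm (complex_of_real (x m) * z) < 1"
      using x01[of m] z by (simp add: norm_mult) (smt (verit) mult_left_le)
    from sibuya_sums_disc[OF this, of \<alpha>] show ?thesis
      using sums_integral_count_space_nat[OF int[of "x m"]] x01[of m] sums_unique2 by fastforce
  qed
  \<comment> \<open>Continuity of the principal power could fail only on the branch cut. The base 1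
    - z has nonnegative real part, so it meets the cut at most at 0, where a power with positive
    exponent is still continuous.\<close>
  have "1 - z \<notin> \<real>\<^sub>\<le>\<^sub>0 \<or> 1 - z = 0"
  proof -
    have "Re z \<le> 1" using complex_Re_le_cmod[of z] z by simp
    moreover have "z = 1" if "Re z = 1" "Im z = 0" using that by (simp add: complex_eq_iff)
    ultimately show ?thesis by (auto simp: complex_nonpos_Reals_iff)
  qed
  then have "(\<lambda>m. 1 - (1 - x m * z) powr \<alpha>) \<longlonglongrightarrow> 1 - (1 - 1 * z) powr \<alpha>"
    using \<alpha> by (intro tendsto_intros xc) auto
  with lim1 have "(LINT k|?N. ?f 1 k) = 1 - (1 - z) powr \<alpha>"
    unfolding val using LIMSEQ_unique by fastforce
  then show ?thesis
    using sums_integral_count_space_nat[OF int[of 1]] by simp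
qed

text \<open>The n-fold convolution of the Sibuya law, built by induction. Only its generating
  function on the closed disc is recorded: points on the circle give characteristic functions,
  points in (0, 1] Laplace transforms.\<close>

lemma ex_sibuya_sum:
  fixes \<alpha> :: real
  assumes \<alpha>: "0 < \<alpha>" "\<alpha> \<le> 1"
  shows "\<exists>M :: nat measure. prob_space M \<and> sets M = UNIV \<and>
    (\<forall>z :: complex. norm z \<le> 1 \<longrightarrow> (LINT k|M. z ^ k) = (1 - (1 - z) powr \<alpha>) ^ n)"
proof (induction n)
  case 0
  have "(LINT k|return (count_space UNIV) (0::nat). z ^ k) = 1" for z :: complex
    by (subst integral_return) auto
  then show ?case
    by (intro exI[of _ "return (count_space UNIV) 0"]) (auto intro: prob_space_return)
next
  case (Suc n)
  then obtain M :: "nat measure" where M: "prob_space M" "sets M = UNIV"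
    and Mz: "\<And>z :: complex. norm z \<le> 1 \<Longrightarrow> (LINT k|M. z ^ k) = (1 - (1 - z) powr \<alpha>) ^ n" by auto
  let ?N = "count_space (UNIV :: nat set)"
  define P where "P = density ?N (sibuya \<alpha>)"
  have setsP: "sets P = UNIV" by (simp add: P_def)
  have dom: "integrable ?N (sibuya \<alpha>)"
    using summable_sibuya[OF \<alpha>] sibuya_nonneg[OF \<alpha>] by (simp add: integrable_count_space_nat_iff)
  have Pz: "(LINT k|P. z ^ k) = 1 - (1 - z) powr \<alpha>" if z: "norm z \<le> 1" for z :: complex
  proof -
    have int: "integrable ?N (\<lambda>k. sibuya \<alpha> k *\<^sub>R z ^ k)"
      using dom by (rule Bochner_Integration.integrable_bound)
        (use sibuya_nonneg[OF \<alpha>] z in \<open>auto simp: norm_mult norm_power intro!: mult_left_le power_le_one\<close>)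
    have "(LINT k|P. z ^ k) = (LINT k|?N. sibuya \<alpha> k *\<^sub>R z ^ k)"
      unfolding P_def using sibuya_nonneg[OF \<alpha>] by (intro integral_density) auto
    then show ?thesis
      using sums_integral_count_space_nat[OF int] sibuya_sums[OF \<alpha> z]
      by (simp add: scaleR_conv_of_real sums_iff)
  qed
  have P: "prob_space P"
  proof (rule prob_spaceI)
    \<comment> \<open>Total mass one is the value of the generating function at z = 1, where (1 -
      z)^\<alpha> = 0.\<close>
    have "sibuya \<alpha> sums 1"
    proof -
      have "(\<lambda>k. complex_of_real (sibuya \<alpha> k)) sums complex_of_real 1"
        using sibuya_sums[OF \<alpha>, of 1] \<alpha> by simp
      then show ?thesis by (simp only: sums_of_real_iff)
    qed
    then show "emeasure P (space P) = 1"
      using sibuya_nonneg[OF \<alpha>]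
      by (simp add: P_def emeasure_density nn_integral_count_space_nat suminf_ennreal_eq sums_unique[symmetric])
  qed
  interpret M: prob_space M by fact
  interpret Q: prob_space P by fact
  interpret pair_prob_space P M ..
  have [measurable_cong]: "sets M = sets ?N" "sets P = sets ?N" using M setsP by auto
  have [measurable]: "(\<lambda>(a, b). a + b) \<in> P \<Otimes>\<^sub>M M \<rightarrow>\<^sub>M ?N" by measurable
  let ?Q = "distr (P \<Otimes>\<^sub>M M) ?N (\<lambda>(a, b). a + b)"
  have "(LINT k|?Q. z ^ k) = (1 - (1 - z) powr \<alpha>) ^ Suc n" if z: "norm z \<le> 1" for z :: complex
  proof -
    have int: "integrable (P \<Otimes>\<^sub>M M) (\<lambda>(a, b). z ^ a * z ^ b)"
    proof (rule integrable_const_bound[of _ 1])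
      show "AE x in P \<Otimes>\<^sub>M M. cmod (case x of (a, b) \<Rightarrow> z ^ a * z ^ b) \<le> 1"
        using z by (auto simp: norm_mult norm_power power_le_one mult_le_one)
    qed measurable
    have "(LINT k|?Q. z ^ k) = (LINT p|(P \<Otimes>\<^sub>M M). (case p of (a, b) \<Rightarrow> z ^ a * z ^ b))"
      by (subst integral_distr) (auto simp: split_beta' power_add)
    also have "\<dots> = (LINT a|P. (LINT b|M. z ^ a * z ^ b))"
      using integral_fst'[OF int] by simp
    also have "\<dots> = (1 - (1 - z) powr \<alpha>) * (1 - (1 - z) powr \<alpha>) ^ n"
      using Mz[OF z] Pz[OF z] by simp
    finally show ?thesis by simp
  qed
  moreover have "prob_space ?Q" by (intro prob_space_distr) measurable
  ultimately show ?case by (intro exI[of _ ?Q]) auto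
qed

text \<open>The quotients tend to the derivative of \<open>exp\<close> at 0. The value 1 assigned at
  \<open>h n = 0\<close> is the continuous extension, so the sequence may hit 0.\<close>

lemma exp_minus_one_over_tendsto:
  fixes h :: "nat \<Rightarrow> complex"
  assumes h: "h \<longlonglongrightarrow> 0"
  shows "(\<lambda>n. if h n = 0 then 1 else (exp (h n) - 1) / h n) \<longlonglongrightarrow> 1"
proof -
  define q where "q x = (if x = 0 then 1 else (exp x - 1) / x)" for x :: complex
  have "((\<lambda>x. (exp x - exp 0) / (x - 0)) \<longlongrightarrow> exp 0) (at (0::complex))"
    using DERIV_exp[of "0::complex"] by (simp add: has_field_derivative_iff)
  then have "(q \<longlongrightarrow> exp 0) (at 0)"
    by (rule Lim_transform_eventually) (auto simp: eventually_at_filter q_def)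
  then have "isCont q 0" by (simp add: isCont_def q_def)
  from isCont_tendsto_compose[OF this h] show ?thesis by (simp add: q_def)
qed

text \<open>The bound on \<open>1 - x n\<close> forces \<open>Re (x n) \<ge> 0\<close>, so that \<open>exp (- x n)\<close> lies in the unit disc as well
  and the two powers can be compared factor by factor.\<close>
lemma one_minus_power_tendsto_exp:
  fixes x :: "nat \<Rightarrow> complex"
  assumes L: "(\<lambda>n. of_nat (Suc n) * x n) \<longlonglongrightarrow> L" and b: "\<And>n. norm (1 - x n) \<le> 1"
  shows "(\<lambda>n. (1 - x n) ^ Suc n) \<longlonglongrightarrow> exp (- L)"
proof -
  have x0: "x \<longlonglongrightarrow> 0"
  proof -
    have "(\<lambda>n. 1 / of_nat (Suc n) :: complex) \<longlonglongrightarrow> 0"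
      using LIMSEQ_Suc[OF lim_1_over_n[where 'a=complex]] by simp
    from tendsto_mult[OF this L] show ?thesis by (simp add: field_simps del: of_nat_Suc)
  qed
  define q where "q n = (if - x n = 0 then 1 else (exp (- x n) - 1) / (- x n))" for n
  have q: "q \<longlonglongrightarrow> 1" unfolding q_def
    by (rule exp_minus_one_over_tendsto) (use tendsto_minus[OF x0] in simp)
  \<comment> \<open>n + 1 times the difference of the bases is a convergent sequence times
    \<open>q n - 1\<close>, hence tends to 0.\<close>
  have eq: "of_nat (Suc n) * ((1 - x n) - exp (- x n)) = (of_nat (Suc n) * x n) * (q n - 1)" for n
    by (auto simp: q_def field_simps simp del: of_nat_Suc)
  have "(\<lambda>n. (of_nat (Suc n) * x n) * (q n - 1)) \<longlonglongrightarrow> L * (1 - 1)"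
    by (intro tendsto_intros L q)
  then have d: "(\<lambda>n. norm ((of_nat (Suc n) * x n) * (q n - 1))) \<longlonglongrightarrow> 0"
    using tendsto_norm_zero by simp
  have "norm ((1 - x n) ^ Suc n - exp (- x n) ^ Suc n) \<le> norm ((of_nat (Suc n) * x n) * (q n - 1))" for n
  proof -
    have "1 - Re (x n) \<le> 1" using complex_Re_le_cmod[of "1 - x n"] b[of n] by simp
    then have "norm (exp (- x n)) \<le> 1" by simp
    then have "norm ((1 - x n) ^ Suc n - exp (- x n) ^ Suc n) \<le> Suc n * norm (1 - x n - exp (- x n))"
      by (intro norm_power_diff b)
    also have "\<dots> = norm (of_nat (Suc n) * (1 - x n - exp (- x n)))" by (simp add: norm_mult del: of_nat_Suc)
    finally show ?thesis by (simp only: eq)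
  qed
  then have "(\<lambda>n. (1 - x n) ^ Suc n - exp (- x n) ^ Suc n) \<longlonglongrightarrow> 0"
    by (intro Lim_null_comparison[OF always_eventually d]) auto
  moreover have "(\<lambda>n. exp (- x n) ^ Suc n) \<longlonglongrightarrow> exp (- L)"
    unfolding exp_of_nat_mult[symmetric] using tendsto_exp[OF tendsto_minus[OF L]] by simp
  ultimately show ?thesis using tendsto_add by fastforce
qed

section \<open>Laplace transform of the one-sided stable law\<close>

text \<open>For nonzero t, the number -i t has modulus |t| and argument -(pi / 2) sgn t, so its
  principal power reproduces the phase in the definition. In this form the characteristic function
  is exp (- w^\<alpha>) at w = -i t, ready to be matched with the Sibuya limit.\<close>

lemma stable_os_char_eq:
  "stable_os_char \<alpha> t = exp (- ((- \<i> * complex_of_real t) powr complex_of_real \<alpha>))"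
proof (cases "t = 0")
  case True then show ?thesis by (simp add: stable_os_char_def)
next
  case False
  have "- \<i> * complex_of_real t = complex_of_real \<bar>t\<bar> * (- \<i> * complex_of_real (sgn t))"
    by (simp add: sgn_real_def)
  then have "(- \<i> * complex_of_real t) powr \<alpha>
    = complex_of_real \<bar>t\<bar> powr \<alpha> * (- \<i> * complex_of_real (sgn t)) powr \<alpha>"
    by (simp only:, intro powr_times_real_left) auto
  also have "complex_of_real \<bar>t\<bar> powr \<alpha> = complex_of_real (\<bar>t\<bar> powr \<alpha>)"
    by (rule powr_of_real) simp
  also have "(- \<i> * complex_of_real (sgn t)) powr \<alpha> = cis (- pi * \<alpha> * sgn t / 2)"
    using False by (auto simp: sgn_real_def powr_def cis_conv_exp mult_ac)
  finally show ?thesis by (simp add: stable_os_char_def)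
qed

text \<open>The scaled Sibuya sums \<open>\<mu> n\<close> satisfy E exp (- w X) -> exp (-
  w^\<alpha>) whenever Re w \<ge> 0. Imaginary w and Levy's continuity theorem give weak convergence
  to \<open>S\<close>; bounded continuous test functions then transfer nonnegativity to
  \<open>S\<close> and identify its Laplace transform with the limit at real w = s.\<close>

lemma one_sided_stable_laplace:
  assumes S: "real_distribution S" and ch: "char S = stable_os_char \<alpha>" and \<alpha>: "0 < \<alpha>" "\<alpha> \<le> 1"
  shows "AE x in S. 0 \<le> x"
    and "0 \<le> s \<Longrightarrow> (LINT x|S. exp (- (s * x))) = exp (- (s powr \<alpha>))"
proof -
  interpret S: real_distribution S by fact
  obtain M :: "nat \<Rightarrow> nat measure" where M: "\<And>n. prob_space (M n)" "\<And>n. sets (M n) = UNIV"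
    and Mz: "\<And>n z. norm (z::complex) \<le> 1 \<Longrightarrow> (LINT k|M n. z ^ k) = (1 - (1 - z) powr \<alpha>) ^ n"
    using ex_sibuya_sum[OF \<alpha>] by metis
  \<comment> \<open>The scale is chosen with m^\<alpha> = n + 1, the number of summands in
    \<open>\<mu> n\<close>; the shift to \<open>Suc n\<close> keeps it positive.\<close>
  define m where "m n = real (Suc n) powr (1 / \<alpha>)" for n
  have m: "0 < m n" for n by (simp add: m_def)
  define \<mu> where "\<mu> n = distr (M (Suc n)) borel (\<lambda>k. real k / m n)" for n
  have [measurable_cong]: "sets (M n) = sets (count_space UNIV)" for n
    using M(2) by simp
  have \<mu>: "real_distribution (\<mu> n)" for n
    unfolding \<mu>_def real_distribution_def real_distribution_axioms_def
    by (auto intro!: prob_space.prob_space_distr[OF M(1)])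
  have lim: "(\<lambda>n. LINT x|\<mu> n. exp (- (w * complex_of_real x))) \<longlonglongrightarrow> exp (- (w powr \<alpha>))"
    if w: "0 \<le> Re w" for w
  proof -
    define h where "h n = - w / complex_of_real (m n)" for n
    have m_inf: "filterlim m at_top sequentially"
      unfolding m_def using \<alpha> by real_asymp
    have h: "h \<longlonglongrightarrow> 0"
    proof -
      have "(\<lambda>n. 1 / m n) \<longlonglongrightarrow> 0" using m_inf by (rule tendsto_divide_0[OF tendsto_const filterlim_at_top_imp_at_infinity])
      from tendsto_mult[OF tendsto_const[of "- w"] tendsto_of_real[OF this]] show ?thesis
        by (simp add: h_def[abs_def])
    qed
    have hn: "norm (exp (h n)) \<le> 1" for n
    proof -
      have "Re (h n) = - (Re w / m n)" by (simp add: h_def Re_divide_of_real)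
      also have "\<dots> \<le> 0" using w m[of n] by simp
      finally show ?thesis by simp
    qed
    define x where "x n = (1 - exp (h n)) powr complex_of_real \<alpha>" for n
    have val: "(LINT x|\<mu> n. exp (- (w * complex_of_real x))) = (1 - x n) ^ Suc n" for n
    proof -
      have e: "exp (- (w * complex_of_real (real k / m n))) = exp (h n) ^ k" for k
        by (subst exp_of_nat_mult[symmetric]) (simp add: h_def mult_ac)
      have "(LINT x|\<mu> n. exp (- (w * complex_of_real x))) = (LINT k|M (Suc n). exp (h n) ^ k)"
        unfolding \<mu>_def by (subst integral_distr) (auto simp only: e, measurable)
      also have "\<dots> = (1 - x n) ^ Suc n" using Mz[OF hn[of n], of "Suc n"] unfolding x_def .
      finally show ?thesis .
    qed
    \<comment> \<open>\<open>1 - x n\<close> is the generating function of a single Sibuya variable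
      (\<open>M 1\<close>) at \<open>exp (h n)\<close>, hence an average of points of the unit
      disc.\<close>
    have xb: "norm (1 - x n) \<le> 1" for n
    proof -
      interpret M1: prob_space "M 1" by (rule M)
      have "norm (LINT k|M 1. exp (h n) ^ k) \<le> (LINT k|M 1. norm (exp (h n) ^ k))"
        by (rule integral_norm_bound)
      also have "\<dots> \<le> (LINT k|M 1. 1)"
        using hn[of n] by (intro integral_mono M1.integrable_const_bound[of _ 1])
          (auto simp: norm_power power_le_one simp del: norm_exp_eq_Re)
      also have "\<dots> = 1" using M1.prob_space by simp
      finally show ?thesis using Mz[OF hn[of n], of 1] by (simp only: x_def power_one_right)
    qed
    have "(\<lambda>n. of_nat (Suc n) * x n) \<longlonglongrightarrow> w powr \<alpha>"
    proof (cases "w = 0")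
      case True
      then show ?thesis by (simp add: x_def h_def)
    next
      case False
      \<comment> \<open>The factor n + 1 = m^\<alpha> moves inside the power because
        \<open>m n\<close> is a positive real; the base m (1 - exp (- w / m)) then tends to
        w.\<close>
      have eq: "of_nat (Suc n) * x n = (complex_of_real (m n) * (1 - exp (h n))) powr \<alpha>" for n
      proof -
        have "(complex_of_real (m n) * (1 - exp (h n))) powr \<alpha> = complex_of_real (m n) powr \<alpha> * x n"
          unfolding x_def by (rule powr_times_real_left) (use m[of n] in auto)
        also have "complex_of_real (m n) powr \<alpha> = complex_of_real (m n powr \<alpha>)"
          using m[of n] by (intro powr_of_real) auto
        also have "m n powr \<alpha> = real (Suc n)" unfolding m_def using \<alpha> by (simp add: powr_powr)
        finally show ?thesis by simp
      qed
      have "(\<lambda>n. w * (if h n = 0 then 1 else (exp (h n) - 1) / h n)) \<longlonglongrightarrow> w * 1"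
        by (intro tendsto_intros exp_minus_one_over_tendsto h)
      moreover have "w * (if h n = 0 then 1 else (exp (h n) - 1) / h n) = complex_of_real (m n) * (1 - exp (h n))" for n
        using False m[of n] by (simp add: h_def field_simps)
      ultimately have "(\<lambda>n. complex_of_real (m n) * (1 - exp (h n))) \<longlonglongrightarrow> w" by simp
      \<comment> \<open>Away from 0, the half-plane Re w \<ge> 0 avoids the branch cut.\<close>
      moreover have "w \<notin> \<real>\<^sub>\<le>\<^sub>0" using w False by (auto simp: complex_nonpos_Reals_iff complex_eq_iff)
      ultimately show ?thesis unfolding eq
        by (intro tendsto_powr_complex) auto
    qed
    then show ?thesis unfolding val using xb by (rule one_minus_power_tendsto_exp)
  qed
  have conv: "weak_conv_m \<mu> S"
  proof (rule levy_continuity[OF \<mu> S])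
    fix t
    show "(\<lambda>n. char (\<mu> n) t) \<longlonglongrightarrow> char S t"
      using lim[of "- \<i> * complex_of_real t"] unfolding ch stable_os_char_eq
      by (simp add: char_def mult_ac)
  qed
  have \<mu>_pos: "AE x in \<mu> n. 0 \<le> x" for n
    unfolding \<mu>_def by (subst AE_distr_iff) (use m[of n] in auto)
  show pos: "AE x in S. 0 \<le> x"
  proof -
    \<comment> \<open>The test function is bounded, continuous, nonnegative and zero exactly on the
      nonnegative half-line, so a vanishing integral means nonnegativity almost surely.\<close>
    have "(\<lambda>n. LINT x|\<mu> n. max 0 (min 1 (- x))) \<longlonglongrightarrow> (LINT x|S. max 0 (min 1 (- x)))"
      by (rule weak_conv_imp_integral_bdd_continuous_conv[OF \<mu> S conv, where B=1])
         (intro continuous_intros, auto)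
    moreover have "(LINT x|\<mu> n. max 0 (min 1 (- x))) = 0" for n
    proof (rule integral_eq_zero_AE)
      show "AE x in \<mu> n. max 0 (min 1 (- x)) = 0" using \<mu>_pos[of n] by eventually_elim auto
    qed
    ultimately have "(LINT x|S. max 0 (min 1 (- x))) = 0"
      by (simp only: LIMSEQ_const_iff)
    moreover have "integrable S (\<lambda>x. max 0 (min 1 (- x)))"
      by (rule S.integrable_const_bound[of _ 1]) auto
    ultimately have "AE x in S. max 0 (min 1 (- x)) = 0"
      by (subst (asm) integral_nonneg_eq_0_iff_AE) auto
    then show ?thesis by eventually_elim (auto simp: max_def min_def split: if_splits)
  qed
  show "(LINT x|S. exp (- (s * x))) = exp (- (s powr \<alpha>))" if s: "0 \<le> s"
  proof -
    \<comment> \<open>Replacing x by \<open>max 0 x\<close> makes the exponential bounded on the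
      whole line and changes nothing almost surely under \<open>\<mu> n\<close> or
      \<open>S\<close>.\<close>
    have "(\<lambda>n. LINT x|\<mu> n. exp (- (s * max 0 x))) \<longlonglongrightarrow> (LINT x|S. exp (- (s * max 0 x)))"
      by (rule weak_conv_imp_integral_bdd_continuous_conv[OF \<mu> S conv, where B=1])
         (use s in \<open>auto intro!: continuous_intros\<close>)
    moreover have "(LINT x|\<mu> n. exp (- (s * max 0 x))) = (LINT x|\<mu> n. exp (- (s * x)))" for n
    proof (rule integral_cong_AE)
      show "AE x in \<mu> n. exp (- (s * max 0 x)) = exp (- (s * x))" using \<mu>_pos[of n] by eventually_elim auto
    qed (auto simp: \<mu>_def)
    moreover have "(LINT x|S. exp (- (s * max 0 x))) = (LINT x|S. exp (- (s * x)))"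
    proof (rule integral_cong_AE)
      show "AE x in S. exp (- (s * max 0 x)) = exp (- (s * x))" using pos by eventually_elim auto
    qed auto
    ultimately have "(\<lambda>n. complex_of_real (LINT x|\<mu> n. exp (- (s * x)))) \<longlonglongrightarrow> complex_of_real (LINT x|S. exp (- (s * x)))"
      by (intro tendsto_of_real) simp
    moreover have "(\<lambda>n. complex_of_real (LINT x|\<mu> n. exp (- (s * x)))) \<longlonglongrightarrow> complex_of_real (exp (- (s powr \<alpha>)))"
    proof -
      have "complex_of_real (LINT x|\<mu> n. exp (- (s * x))) = (LINT x|\<mu> n. exp (- (complex_of_real s * complex_of_real x)))" for n
        by (subst integral_complex_of_real[symmetric]) (simp add: exp_of_real[symmetric])
      then show ?thesis using lim[of "complex_of_real s"] s by (simp add: powr_of_real exp_of_real[symmetric])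
    qed
    ultimately show ?thesis using LIMSEQ_unique of_real_eq_iff by blast
  qed
qed

section \<open>Scale mixtures\<close>

text \<open>Conditioning on d, by Fubini: the inner integral is the characteristic function of
  \<open>A\<close> at \<open>t * f d\<close>. This serves both the normal mixtures and the symmetric
  stable one.\<close>

lemma char_distr_scale_mixture:
  assumes A: "real_distribution A" and D: "prob_space D" and f [measurable]: "f \<in> borel_measurable D"
  shows "char (distr (A \<Otimes>\<^sub>M D) borel (\<lambda>(x, d). x * f d)) t = (LINT d|D. char A (t * f d))"
proof -
  interpret A: real_distribution A by fact
  interpret D: prob_space D by fact
  interpret pair_prob_space A D ..
  have int: "integrable (A \<Otimes>\<^sub>M D) (\<lambda>(x, d). iexp (t * f d * x))"
    by (rule integrable_const_bound[of _ 1]) (auto simp: split_beta' simp flip: of_real_mult)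
  have "char (distr (A \<Otimes>\<^sub>M D) borel (\<lambda>(x, d). x * f d)) t
      = (LINT p|(A \<Otimes>\<^sub>M D). (case p of (x, d) \<Rightarrow> iexp (t * f d * x)))"
    unfolding char_def by (subst integral_distr) (auto simp: split_beta' mult_ac)
  also have "\<dots> = (LINT d|D. (LINT x|A. iexp (t * f d * x)))"
    using integral_snd[OF int] by simp
  finally show ?thesis by (simp add: char_def)
qed

text \<open>Given d the law is normal with variance \<open>f d\<close>, so the characteristic
  function at t becomes the Laplace transform of \<open>f\<close> at t^2 / 2.\<close>

lemma char_distr_normal_mixture:
  assumes D: "prob_space D" and f [measurable]: "f \<in> borel_measurable D" and pos: "AE d in D. 0 \<le> f d"
  shows "char (distr (std_normal_distribution \<Otimes>\<^sub>M D) borel (\<lambda>(x, d). x * sqrt (f d))) t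
    = complex_of_real (LINT d|D. exp (- (t\<^sup>2 / 2 * f d)))"
proof -
  have "char (distr (std_normal_distribution \<Otimes>\<^sub>M D) borel (\<lambda>(x, d). x * sqrt (f d))) t
    = (LINT d|D. complex_of_real (exp (- (t * sqrt (f d))\<^sup>2 / 2)))"
    by (subst char_distr_scale_mixture[OF real_dist_normal_dist D]) (simp_all add: char_std_normal_distribution)
  also have "\<dots> = (LINT d|D. complex_of_real (exp (- (t\<^sup>2 / 2 * f d))))"
  proof (rule integral_cong_AE)
    show "AE d in D. complex_of_real (exp (- (t * sqrt (f d))\<^sup>2 / 2)) = complex_of_real (exp (- (t\<^sup>2 / 2 * f d)))"
      using pos by eventually_elim (simp add: power_mult_distrib)
  qed measurable
  finally show ?thesis by simp
qed

lemma real_distribution_distr_pair: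
  assumes "prob_space A" "prob_space D" "f \<in> borel_measurable (A \<Otimes>\<^sub>M D)"
  shows "real_distribution (distr (A \<Otimes>\<^sub>M D) borel f)"
proof -
  interpret A: prob_space A by fact
  interpret D: prob_space D by fact
  interpret pair_prob_space A D ..
  show ?thesis using assms(3) by (simp add: real_distribution_def real_distribution_axioms_def prob_space_distr)
qed

section \<open>Exchanging the gamma factor for Z and an exponential variable\<close>

lemma sets_exp1_distr [simp, measurable_cong]: "sets exp1_distr = sets borel"
  by (simp add: exp1_distr_def)

lemma prob_space_exp1_distr: "prob_space exp1_distr"
  unfolding exp1_distr_def by (rule prob_space_exponential_density) simp

lemma measure_exp1_distr_atLeast:
  assumes "0 \<le> c" shows "measure exp1_distr {c..} = exp (- c)"
proof -
  interpret prob_space exp1_distr by (rule prob_space_exp1_distr)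
  have "distributed exp1_distr lborel (\<lambda>x. x) (exponential_density 1)"
    by (auto simp: distributed_def exp1_distr_def distr_id2 exponential_density_def cong: distr_cong)
  from exponential_distributedD_gt[OF this assms]
  have *: "measure exp1_distr {c<..} = exp (- c)"
    by (simp add: exp1_distr_def greaterThan_def)
  have "AE x in exp1_distr. x \<noteq> c"
    unfolding exp1_distr_def using AE_lborel_singleton[of c]
    by (subst AE_density) (auto elim: eventually_mono)
  then have "measure exp1_distr {c..} = measure exp1_distr {c<..}"
    by (intro finite_measure_eq_AE) (auto elim!: eventually_mono)
  then show ?thesis using * by simp
qed

lemma AE_exp1_distr_pos: "AE w in exp1_distr. 0 < w"
proof -
  have "AE w in lborel. (0::real) < ennreal (exponential_density 1 w) \<longrightarrow> 0 < w"
    using AE_lborel_singleton[of "0::real"]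
    by eventually_elim (auto simp: exponential_density_def split: if_splits)
  then show ?thesis unfolding exp1_distr_def by (subst AE_density) auto
qed

text \<open>Both sides are the probability that \<open>W \<ge> c G\<^bsup>-1/\<alpha>\<^esup>\<close>, conditioned on \<open>G\<close> on the left and
  on \<open>W\<close> on the right.\<close>
lemma gamma_power_laplace_eq_Z_exp:
  assumes r: "0 < r" "r \<le> 1" and \<alpha>: "0 < \<alpha>" and c: "0 \<le> c"
  shows "(LINT x|gamma_distr r. exp (- (c * x powr (- 1 / \<alpha>))))
    = (LINT p|(Z_distr r \<Otimes>\<^sub>M exp1_distr). (case p of (z, w) \<Rightarrow> exp (- ((c / w) powr \<alpha> * z))))"
proof -
  let ?G = "gamma_distr r" and ?Z = "Z_distr r" and ?W = exp1_distr
  interpret G: prob_space ?G using r by (intro prob_space_gamma_distr) auto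
  interpret Z: prob_space ?Z using r by (intro prob_space_Z_distr) auto
  interpret W: prob_space ?W by (rule prob_space_exp1_distr)
  interpret ZW: pair_prob_space ?Z ?W ..
  interpret GW: pair_prob_space ?G ?W ..
  \<comment> \<open>Both inequalities say c / w \<le> x^(1 / \<alpha>); this trades a condition on w
    given x for one on x given w.\<close>
  have key: "(c / w) powr \<alpha> \<le> x \<longleftrightarrow> c * x powr (- 1 / \<alpha>) \<le> w" if "0 < x" "0 < w" for x w
  proof -
    have "(c / w) powr \<alpha> \<le> x \<longleftrightarrow> c / w \<le> x powr (1 / \<alpha>)"
    proof
      assume "(c / w) powr \<alpha> \<le> x"
      then have "((c / w) powr \<alpha>) powr (1 / \<alpha>) \<le> x powr (1 / \<alpha>)" using \<alpha> by (intro powr_mono2) auto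
      then show "c / w \<le> x powr (1 / \<alpha>)" using \<alpha> c that by (simp add: powr_powr)
    next
      assume "c / w \<le> x powr (1 / \<alpha>)"
      then have "(c / w) powr \<alpha> \<le> (x powr (1 / \<alpha>)) powr \<alpha>" using \<alpha> c that by (intro powr_mono2) auto
      then show "(c / w) powr \<alpha> \<le> x" using \<alpha> c that by (simp add: powr_powr)
    qed
    also have "\<dots> \<longleftrightarrow> c * x powr (- 1 / \<alpha>) \<le> w"
      using that by (simp add: powr_minus_divide field_simps)
    finally show ?thesis .
  qed
  have "(LINT x|?G. exp (- (c * x powr (- 1 / \<alpha>))))
    = (LINT x|?G. (LINT w|?W. indicator {p. (c / snd p) powr \<alpha> \<le> fst p} (x, w)))"
  proof (rule integral_cong_AE)
    show "AE x in ?G. exp (- (c * x powr (- 1 / \<alpha>)))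
      = (LINT w|?W. indicator {p. (c / snd p) powr \<alpha> \<le> fst p} (x, w))"
      using AE_gamma_distr_pos[OF r(1)]
    proof eventually_elim
      case (elim x)
      have "(LINT w|?W. indicator {p. (c / snd p) powr \<alpha> \<le> fst p} (x, w))
        = (LINT w|?W. indicator {c * x powr (- 1 / \<alpha>)..} w :: real)"
      proof (rule integral_cong_AE)
        show "AE w in ?W. indicator {p. (c / snd p) powr \<alpha> \<le> fst p} (x, w)
          = (indicator {c * x powr (- 1 / \<alpha>)..} w :: real)"
          using AE_exp1_distr_pos by eventually_elim (use key elim in \<open>auto simp: indicator_def\<close>)
      qed measurable
      also have "\<dots> = exp (- (c * x powr (- 1 / \<alpha>)))"
        using measure_exp1_distr_atLeast[of "c * x powr (- 1 / \<alpha>)"] c by simp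
      finally show ?case by simp
    qed
  qed measurable
  also have "\<dots> = (LINT w|?W. (LINT x|?G. indicator {p. (c / snd p) powr \<alpha> \<le> fst p} (x, w)))"
    by (rule GW.Fubini_integral[symmetric])
       (rule GW.integrable_const_bound[of _ 1], auto simp: indicator_def split_beta')
  also have "\<dots> = (LINT w|?W. (LINT z|?Z. exp (- ((c / w) powr \<alpha> * z))))"
  \<comment> \<open>For fixed w the inner integral is P(G \<ge> u) with u = (c / w)^\<alpha>, which
    is the Laplace transform of Z at u. The identity holds for every w because u is always
    nonnegative.\<close>
  proof (rule Bochner_Integration.integral_cong[OF refl])
    fix w
    have "(LINT x|?G. indicator {p. (c / snd p) powr \<alpha> \<le> fst p} (x, w))
      = (LINT x|?G. indicator {(c / w) powr \<alpha>..} x :: real)"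
      by (intro Bochner_Integration.integral_cong) (auto simp: indicator_def)
    then show "(LINT x|?G. indicator {p. (c / snd p) powr \<alpha> \<le> fst p} (x, w))
      = (LINT z|?Z. exp (- ((c / w) powr \<alpha> * z)))"
      using Z_distr_laplace[OF r, of "(c / w) powr \<alpha>"] by simp
  qed
  also have "\<dots> = (LINT p|(?Z \<Otimes>\<^sub>M ?W). (case p of (z, w) \<Rightarrow> exp (- ((c / w) powr \<alpha> * z))))"
  proof (rule ZW.integral_snd, rule ZW.integrable_const_bound[of _ 1])
    show "AE p in ?Z \<Otimes>\<^sub>M ?W. norm (case p of (z, w) \<Rightarrow> exp (- ((c / w) powr \<alpha> * z))) \<le> 1"
    proof (rule ZW.AE_pair_measure)
      show "AE z in ?Z. AE w in ?W. norm (case (z, w) of (z, w) \<Rightarrow> exp (- ((c / w) powr \<alpha> * z))) \<le> 1"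
        using AE_Z_distr_nonneg[OF r] by eventually_elim auto
    qed measurable
  qed measurable
  finally show ?thesis .
qed

text \<open>By uniqueness of characteristic functions it suffices that all three equal the common
  \<open>T\<close>. The first is the exchange of the gamma factor for Z and W; in the second,
  integrating out the stable factor turns z^(1 / \<alpha>) into z; in the third, the power 2
  \<alpha> of the square root does the same.\<close>

lemma normal_gen_gamma_representations:
  assumes r: "0 < r" "r \<le> 1" and \<alpha>: "0 < \<alpha>" "\<alpha> \<le> 1"
    and S1: "real_distribution S1" "char S1 = stable_os_char \<alpha>"
    and S2: "real_distribution S2" "char S2 = stable_sym_char \<alpha>"
  shows "distr (std_normal_distribution \<Otimes>\<^sub>M gen_gamma_distr r (- \<alpha>) 1) borel
             (\<lambda>(x, g). x * sqrt g)
           = distr (std_normal_distribution \<Otimes>\<^sub>M (S1 \<Otimes>\<^sub>M (Z_distr r \<Otimes>\<^sub>M exp1_distr))) borel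
             (\<lambda>(x, s, z, w). x * sqrt (s * z powr (1 / \<alpha>) / w))" (is "?D1 = ?D2")
    and "distr (std_normal_distribution \<Otimes>\<^sub>M (S1 \<Otimes>\<^sub>M (Z_distr r \<Otimes>\<^sub>M exp1_distr))) borel
             (\<lambda>(x, s, z, w). x * sqrt (s * z powr (1 / \<alpha>) / w))
           = distr (S2 \<Otimes>\<^sub>M (Z_distr r \<Otimes>\<^sub>M exp1_distr)) borel
             (\<lambda>(s, z, w). s * sqrt (z powr (1 / \<alpha>) / (2 * w)))" (is "_ = ?D3")
proof -
  let ?Z = "Z_distr r" and ?W = exp1_distr
  interpret N: real_distribution std_normal_distribution by (rule real_dist_normal_dist)
  interpret S1: real_distribution S1 by fact
  interpret S2: real_distribution S2 by fact
  interpret G: prob_space "gamma_distr r" using r by (intro prob_space_gamma_distr) auto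
  interpret Z: prob_space ?Z using r by (intro prob_space_Z_distr) auto
  interpret W: prob_space ?W by (rule prob_space_exp1_distr)
  interpret ZW: pair_prob_space ?Z ?W ..
  interpret S1ZW: pair_prob_space S1 "?Z \<Otimes>\<^sub>M ?W" ..
  have gg: "gen_gamma_distr r (- \<alpha>) 1 = distr (gamma_distr r) borel (\<lambda>x. x powr (- 1 / \<alpha>))"
    using gen_gamma_distr_eq_distr_gamma[of r "- \<alpha>" 1] r \<alpha> by simp
  interpret GG: prob_space "gen_gamma_distr r (- \<alpha>) 1"
    unfolding gg by (intro G.prob_space_distr) measurable
  have [measurable_cong]: "sets (gen_gamma_distr r (- \<alpha>) 1) = sets borel" by (simp add: gg)
  define T where "T t = complex_of_real (LINT p|(?Z \<Otimes>\<^sub>M ?W). (case p of (z, w) \<Rightarrow> exp (- ((t\<^sup>2 / 2 / w) powr \<alpha> * z))))" for t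
  have AE_ZW: "AE p in ?Z \<Otimes>\<^sub>M ?W. 0 \<le> fst p \<and> 0 < snd p"
  proof (rule ZW.AE_pair_measure)
    show "AE z in ?Z. AE w in ?W. 0 \<le> fst (z, w) \<and> 0 < snd (z, w)"
      using AE_Z_distr_nonneg[OF r] by eventually_elim (use AE_exp1_distr_pos in auto)
  qed measurable
  have AE_SZW: "AE q in S1 \<Otimes>\<^sub>M (?Z \<Otimes>\<^sub>M ?W). 0 \<le> fst q \<and> 0 \<le> fst (snd q) \<and> 0 < snd (snd q)"
  proof (rule S1ZW.AE_pair_measure)
    show "AE s in S1. AE p in ?Z \<Otimes>\<^sub>M ?W. 0 \<le> fst (s, p) \<and> 0 \<le> fst (snd (s, p)) \<and> 0 < snd (snd (s, p))"
      using one_sided_stable_laplace(1)[OF S1 \<alpha>] by eventually_elim (use AE_ZW in auto)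
  qed measurable
  have c1: "char ?D1 t = T t" for t
  proof -
    have "AE x in gen_gamma_distr r (- \<alpha>) 1. 0 \<le> x"
      unfolding gg by (subst AE_distr_iff) auto
    then have "char ?D1 t = complex_of_real (LINT g|gen_gamma_distr r (- \<alpha>) 1. exp (- (t\<^sup>2 / 2 * g)))"
      by (intro char_distr_normal_mixture GG.prob_space_axioms) measurable
    also have "(LINT g|gen_gamma_distr r (- \<alpha>) 1. exp (- (t\<^sup>2 / 2 * g)))
      = (LINT x|gamma_distr r. exp (- (t\<^sup>2 / 2 * x powr (- 1 / \<alpha>))))"
      unfolding gg by (subst integral_distr) auto
    finally show ?thesis
      unfolding T_def using gamma_power_laplace_eq_Z_exp[OF r \<alpha>(1), of "t\<^sup>2 / 2"] by simp
  qed
  define f where "f q = (case q of (s, z, w) \<Rightarrow> s * z powr (1 / \<alpha>) / w)" for q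
  have f_meas [measurable]: "f \<in> borel_measurable (S1 \<Otimes>\<^sub>M (?Z \<Otimes>\<^sub>M ?W))"
    unfolding f_def by measurable
  have D2: "?D2 = distr (std_normal_distribution \<Otimes>\<^sub>M (S1 \<Otimes>\<^sub>M (?Z \<Otimes>\<^sub>M ?W))) borel (\<lambda>(x, q). x * sqrt (f q))"
    by (simp add: f_def split_beta')
  have c2: "char ?D2 t = T t" for t
  proof -
    have "AE q in S1 \<Otimes>\<^sub>M (?Z \<Otimes>\<^sub>M ?W). 0 \<le> f q"
      using AE_SZW by eventually_elim (auto simp: f_def split_beta')
    then have "char ?D2 t = complex_of_real (LINT q|(S1 \<Otimes>\<^sub>M (?Z \<Otimes>\<^sub>M ?W)). exp (- (t\<^sup>2 / 2 * f q)))"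
      unfolding D2 by (intro char_distr_normal_mixture S1ZW.prob_space_axioms) measurable
    also have "(LINT q|(S1 \<Otimes>\<^sub>M (?Z \<Otimes>\<^sub>M ?W)). exp (- (t\<^sup>2 / 2 * f q)))
      = (LINT q|(S1 \<Otimes>\<^sub>M (?Z \<Otimes>\<^sub>M ?W)). (case q of (s, p) \<Rightarrow> exp (- (t\<^sup>2 / 2 * f (s, p)))))"
      by (simp add: split_beta')
    \<comment> \<open>The stable variable is integrated first, since its Laplace transform is
      explicit; it is evaluated at t^2 / (2 w) z^(1 / \<alpha>).\<close>
    also have "\<dots> = (LINT p|(?Z \<Otimes>\<^sub>M ?W). (LINT s|S1. exp (- (t\<^sup>2 / 2 * f (s, p)))))"
    proof (rule S1ZW.integral_snd[symmetric], rule S1ZW.integrable_const_bound[of _ 1])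
      show "AE q in S1 \<Otimes>\<^sub>M (?Z \<Otimes>\<^sub>M ?W). norm (case q of (s, p) \<Rightarrow> exp (- (t\<^sup>2 / 2 * f (s, p)))) \<le> 1"
        using AE_SZW by eventually_elim (auto simp: f_def split_beta')
    qed measurable
    also have "\<dots> = (LINT p|(?Z \<Otimes>\<^sub>M ?W). (case p of (z, w) \<Rightarrow> exp (- ((t\<^sup>2 / 2 / w) powr \<alpha> * z))))"
    proof (rule integral_cong_AE)
      show "AE p in ?Z \<Otimes>\<^sub>M ?W. (LINT s|S1. exp (- (t\<^sup>2 / 2 * f (s, p))))
        = (case p of (z, w) \<Rightarrow> exp (- ((t\<^sup>2 / 2 / w) powr \<alpha> * z)))"
        using AE_ZW
      proof eventually_elim
        case (elim p)
        define z w where "z = fst p" and "w = snd p"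
        have zw: "0 \<le> z" "0 < w" "p = (z, w)" using elim by (auto simp: z_def w_def)
        have e: "t\<^sup>2 / 2 * f (s, p) = (t\<^sup>2 / 2 / w * z powr (1 / \<alpha>)) * s" for s
          using zw by (simp add: f_def)
        have "(LINT s|S1. exp (- (t\<^sup>2 / 2 * f (s, p)))) = exp (- ((t\<^sup>2 / 2 / w * z powr (1 / \<alpha>)) powr \<alpha>))"
          unfolding e using zw by (intro one_sided_stable_laplace(2)[OF S1 \<alpha>]) simp
        also have "(t\<^sup>2 / 2 / w * z powr (1 / \<alpha>)) powr \<alpha> = (t\<^sup>2 / 2 / w) powr \<alpha> * z"
          using zw \<alpha> by (subst powr_mult) (auto simp: powr_powr)
        finally show ?case using zw by simp
      qed
    qed measurable
    finally show ?thesis by (simp add: T_def)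
  qed
  have c3: "char ?D3 t = T t" for t
  proof -
    have "?D3 = distr (S2 \<Otimes>\<^sub>M (?Z \<Otimes>\<^sub>M ?W)) borel (\<lambda>(s, p). s * (\<lambda>(z, w). sqrt (z powr (1 / \<alpha>) / (2 * w))) p)"
      by (simp add: split_beta')
    then have "char ?D3 t = (LINT p|(?Z \<Otimes>\<^sub>M ?W). char S2 (t * (\<lambda>(z, w). sqrt (z powr (1 / \<alpha>) / (2 * w))) p))"
      by (simp only:, intro char_distr_scale_mixture S2 ZW.prob_space_axioms) measurable
    also have "\<dots> = (LINT p|(?Z \<Otimes>\<^sub>M ?W). complex_of_real (case p of (z, w) \<Rightarrow> exp (- ((t\<^sup>2 / 2 / w) powr \<alpha> * z))))"
    proof (rule integral_cong_AE)
      show "AE p in ?Z \<Otimes>\<^sub>M ?W. char S2 (t * (\<lambda>(z, w). sqrt (z powr (1 / \<alpha>) / (2 * w))) p)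
        = complex_of_real (case p of (z, w) \<Rightarrow> exp (- ((t\<^sup>2 / 2 / w) powr \<alpha> * z)))"
        using AE_ZW
      proof eventually_elim
        case (elim p)
        define z w where "z = fst p" and "w = snd p"
        have zw: "0 \<le> z" "0 < w" "p = (z, w)" using elim by (auto simp: z_def w_def)
        define y where "y = z powr (1 / \<alpha>) / (2 * w)"
        have y: "0 \<le> y" using zw by (simp add: y_def)
        \<comment> \<open>The 2 under the root supplies the factor 1/2 that the normal variable
          contributes in the other two laws.\<close>
        have "\<bar>t * sqrt y\<bar> powr (2 * \<alpha>) = (\<bar>t * sqrt y\<bar> powr 2) powr \<alpha>" by (simp only: powr_powr)
        also have "\<bar>t * sqrt y\<bar> powr 2 = t\<^sup>2 * y" using y by (simp add: power_mult_distrib)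
        also have "t\<^sup>2 * y = t\<^sup>2 / 2 / w * z powr (1 / \<alpha>)" by (simp add: y_def)
        also have "(t\<^sup>2 / 2 / w * z powr (1 / \<alpha>)) powr \<alpha> = (t\<^sup>2 / 2 / w) powr \<alpha> * z"
          using zw \<alpha> by (subst powr_mult) (auto simp: powr_powr)
        finally show ?case using zw S2(2) by (simp add: stable_sym_char_def y_def)
      qed
    qed measurable
    finally show ?thesis by (simp add: T_def)
  qed
  have R: "real_distribution ?D1" "real_distribution ?D2" "real_distribution ?D3"
    by (intro real_distribution_distr_pair N.prob_space_axioms GG.prob_space_axioms
        S1ZW.prob_space_axioms S2.prob_space_axioms ZW.prob_space_axioms; measurable)+
  show "?D1 = ?D2" using R c1 c2 by (intro Levy_uniqueness) auto
  show "?D2 = ?D3" using R c2 c3 by (intro Levy_uniqueness) auto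
qed

section \<open>Random sample sizes\<close>

lemma Skorohod_representation:
  assumes "\<And>k. real_distribution (\<mu> k)" "real_distribution \<nu>" "weak_conv_m \<mu> \<nu>"
  obtains \<Omega> :: "real measure" and Y_seq Y where "prob_space \<Omega>"
    "\<And>n. Y_seq n \<in> borel_measurable \<Omega>" "Y \<in> borel_measurable \<Omega>"
    "\<And>n. distr \<Omega> borel (Y_seq n) = \<mu> n" "distr \<Omega> borel Y = \<nu>"
    "\<And>x. x \<in> space \<Omega> \<Longrightarrow> (\<lambda>n. Y_seq n x) \<longlonglongrightarrow> Y x"
  using Skorohod[OF assms] by force

text \<open>On a Skorohod space the integrands \<open>iexp (a n * Y_seq (k n) x)\<close> converge
  pointwise and are bounded by 1. Index and argument vary together because later both depend on the
  sample size.\<close>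

lemma weak_conv_char_continuously:
  assumes \<mu>: "\<And>k. real_distribution (\<mu> k)" and \<nu>: "real_distribution \<nu>" and conv: "weak_conv_m \<mu> \<nu>"
    and k: "filterlim k at_top sequentially" and a: "a \<longlonglongrightarrow> a0"
  shows "(\<lambda>n. char (\<mu> (k n)) (a n)) \<longlonglongrightarrow> char \<nu> a0"
proof -
  obtain \<Omega> :: "real measure" and Y_seq Y where \<Omega>: "prob_space \<Omega>"
    and [measurable]: "\<And>n. Y_seq n \<in> borel_measurable \<Omega>" "Y \<in> borel_measurable \<Omega>"
    and d: "\<And>n. distr \<Omega> borel (Y_seq n) = \<mu> n" "distr \<Omega> borel Y = \<nu>"
    and lim: "\<And>x. x \<in> space \<Omega> \<Longrightarrow> (\<lambda>n. Y_seq n x) \<longlonglongrightarrow> Y x"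
    using Skorohod_representation[OF \<mu> \<nu> conv] by metis
  interpret prob_space \<Omega> by fact
  have "(\<lambda>n. LINT x|\<Omega>. iexp (a n * Y_seq (k n) x)) \<longlonglongrightarrow> (LINT x|\<Omega>. iexp (a0 * Y x))"
  proof (rule integral_dominated_convergence[where w="\<lambda>_. 1"])
    show "AE x in \<Omega>. (\<lambda>n. iexp (a n * Y_seq (k n) x)) \<longlonglongrightarrow> iexp (a0 * Y x)"
      by (intro AE_I2 tendsto_intros a filterlim_compose[OF lim k])
  qed (auto simp flip: of_real_mult)
  moreover have "(LINT x|\<Omega>. iexp (b * Y_seq m x)) = char (\<mu> m) b" for b m
    unfolding d(1)[symmetric] char_def by (subst integral_distr) auto
  moreover have "(LINT x|\<Omega>. iexp (a0 * Y x)) = char \<nu> a0"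
    unfolding d(2)[symmetric] char_def by (subst integral_distr) auto
  ultimately show ?thesis by simp
qed

section \<open>Generalized negative binomial laws as mixed Poisson laws\<close>

text \<open>The rate n^(-a) is a pure scaling: (n^a x)^(1 / a) = n x^(1 / a) for x > 0. Thus the
  Poisson parameter of the sample size is n V with V = G^(1 / a).\<close>

lemma gen_gamma_distr_eq_distr_gamma_scaled:
  assumes r: "0 < r" and a: "a \<noteq> 0" and n: "1 \<le> n"
  shows "gen_gamma_distr r a (1 / real n powr a) = distr (gamma_distr r) borel (\<lambda>x. real n * x powr (1 / a))"
proof -
  have "gen_gamma_distr r a (1 / real n powr a) = distr (gamma_distr r) borel (\<lambda>x. (x / (1 / real n powr a)) powr (1 / a))"
    using assms by (intro gen_gamma_distr_eq_distr_gamma) auto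
  also have "\<dots> = distr (gamma_distr r) borel (\<lambda>x. real n * x powr (1 / a))"
  proof (rule distr_cong_AE)
    show "AE x in gamma_distr r. (x / (1 / real n powr a)) powr (1 / a) = real n * x powr (1 / a)"
      using AE_gamma_distr_pos[OF r] by eventually_elim (use a n in \<open>simp add: powr_mult powr_powr\<close>)
  qed auto
  finally show ?thesis .
qed

text \<open>A Poisson variable with parameter z has generating function exp (z (q - 1)), and z is
  mixed over the generalized gamma law. Both integrals are expanded into series over k, whose terms
  coincide by the definition of \<open>gen_negbin_prob\<close>.\<close>

lemma gen_negbin_pgf:
  fixes N :: "'s \<Rightarrow> nat" and q :: complex
  assumes M: "prob_space M" and N: "N \<in> measurable M (count_space UNIV)"
    and P: "\<And>k. measure M {\<omega> \<in> space M. N \<omega> = k} = gen_negbin_prob r a l k"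
    and r: "0 < r" and a: "a \<noteq> 0" and l: "0 < l" and q: "norm q \<le> 1"
  shows "(LINT \<omega>|M. q ^ N \<omega>) = (LINT z|gen_gamma_distr r a l. exp (complex_of_real z * (q - 1)))"
proof -
  interpret M: prob_space M by fact
  note N [measurable]
  let ?G = "gen_gamma_distr r a l" and ?p = "gen_negbin_prob r a l"
  have nn: "0 \<le> gen_gamma_density r a l x" for x using r by (rule gen_gamma_density_nonneg)
  have [measurable_cong]: "sets ?G = sets borel" by (simp add: gen_gamma_distr_def)
  interpret G: prob_space ?G
    unfolding gen_gamma_distr_eq_distr_gamma[OF r a l]
    by (intro prob_space.prob_space_distr prob_space_gamma_distr) (use r in auto)
  have Gpos: "AE z in ?G. 0 < z"
    unfolding gen_gamma_distr_def by (subst AE_density) (auto simp: gen_gamma_density_def)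
  have p_eq: "?p k = (LINT z|?G. exp (- z) * z ^ k / fact k)" for k
    unfolding gen_negbin_prob_def gen_gamma_distr_def using nn
    by (subst integral_density) (auto simp: mult_ac simp flip: integral_mult_right_zero)
  have p0: "0 \<le> ?p k" for k using P[of k] by (metis measure_nonneg)
  \<comment> \<open>Summability comes from countable additivity over the disjoint events N = k; the
    weights then dominate both series.\<close>
  have p_sum: "summable ?p"
  proof -
    have "(\<lambda>k. measure M {\<omega> \<in> space M. N \<omega> = k}) sums measure M (\<Union>k. {\<omega> \<in> space M. N \<omega> = k})"
      by (rule M.finite_measure_UNION) (auto simp: disjoint_family_on_def)
    then show ?thesis by (simp add: P sums_iff)
  qed
  have pq: "norm (complex_of_real (?p k) * q ^ k) \<le> ?p k" for k
    using p0[of k] q by (auto simp: norm_mult norm_power power_le_one mult_left_le)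
  have "(\<lambda>k. LINT \<omega>|M. indicator {\<omega> \<in> space M. N \<omega> = k} \<omega> *\<^sub>R q ^ k)
    sums (LINT \<omega>|M. (\<Sum>k. indicator {\<omega> \<in> space M. N \<omega> = k} \<omega> *\<^sub>R q ^ k))"
  proof (rule sums_integral)
    show "integrable M (\<lambda>\<omega>. indicator {\<omega> \<in> space M. N \<omega> = k} \<omega> *\<^sub>R q ^ k)" for k
      by (rule M.integrable_const_bound[of _ 1]) (use q in \<open>auto simp: indicator_def norm_power power_le_one\<close>)
    show "AE \<omega> in M. summable (\<lambda>k. norm (indicator {\<omega> \<in> space M. N \<omega> = k} \<omega> *\<^sub>R q ^ k))"
    proof (rule AE_I2)
      fix \<omega>
      show "summable (\<lambda>k. norm (indicator {\<omega> \<in> space M. N \<omega> = k} \<omega> *\<^sub>R q ^ k))"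
        by (rule summable_finite[of "{N \<omega>}"]) auto
    qed
    show "summable (\<lambda>k. LINT \<omega>|M. norm (indicator {\<omega> \<in> space M. N \<omega> = k} \<omega> *\<^sub>R q ^ k))"
    proof (rule summable_comparison_test'[OF p_sum])
      fix k
      have "(LINT \<omega>|M. norm (indicator {\<omega> \<in> space M. N \<omega> = k} \<omega> *\<^sub>R q ^ k))
        = (LINT \<omega>|M. indicator {\<omega> \<in> space M. N \<omega> = k} \<omega> * norm (q ^ k))"
        by (intro Bochner_Integration.integral_cong) (auto simp: indicator_def)
      also have "\<dots> = ?p k * norm (q ^ k)" using P[of k] by (simp add: Int_def cong: conj_cong)
      finally have eq: "(LINT \<omega>|M. norm (indicator {\<omega> \<in> space M. N \<omega> = k} \<omega> *\<^sub>R q ^ k)) = ?p k * norm (q ^ k)" .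
      show "norm (LINT \<omega>|M. norm (indicator {\<omega> \<in> space M. N \<omega> = k} \<omega> *\<^sub>R q ^ k)) \<le> ?p k"
        unfolding eq using pq[of k] p0[of k] by (simp add: norm_mult)
    qed
  qed
  moreover have "(LINT \<omega>|M. indicator {\<omega> \<in> space M. N \<omega> = k} \<omega> *\<^sub>R q ^ k) = complex_of_real (?p k) * q ^ k" for k
    using P[of k] by (simp add: Int_def scaleR_conv_of_real cong: conj_cong)
  moreover have "(LINT \<omega>|M. (\<Sum>k. indicator {\<omega> \<in> space M. N \<omega> = k} \<omega> *\<^sub>R q ^ k)) = (LINT \<omega>|M. q ^ N \<omega>)"
  proof (rule Bochner_Integration.integral_cong[OF refl])
    fix \<omega> assume "\<omega> \<in> space M"
    then show "(\<Sum>k. indicator {\<omega> \<in> space M. N \<omega> = k} \<omega> *\<^sub>R q ^ k) = q ^ N \<omega>"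
      by (subst suminf_finite[of "{N \<omega>}"]) auto
  qed
  ultimately have L: "(\<lambda>k. complex_of_real (?p k) * q ^ k) sums (LINT \<omega>|M. q ^ N \<omega>)" by simp
  let ?f = "\<lambda>k z. complex_of_real (exp (- z) * z ^ k / fact k) * q ^ k"
  have poisson: "(\<lambda>k. ?f k z) sums exp (complex_of_real z * (q - 1))" for z
  proof -
    have "(\<lambda>k. (complex_of_real z * q) ^ k /\<^sub>R fact k) sums exp (complex_of_real z * q)"
      by (rule exp_converges)
    from sums_mult[OF this, of "exp (- complex_of_real z)"] show ?thesis
      by (simp add: exp_add[symmetric] exp_of_real[symmetric] scaleR_conv_of_real field_simps power_mult_distrib)
  qed
  \<comment> \<open>A Poisson weight is at most 1, being a single term of the exponential series
    times \<open>exp (- z)\<close>; this gives integrability for each k.\<close>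
  have wle: "exp (- z) * z ^ k / fact k \<le> 1" "0 \<le> exp (- z) * z ^ k / fact k" if "0 < z" for z :: real and k
  proof -
    have "z ^ k /\<^sub>R fact k \<le> exp z"
      using sum_le_suminf[OF summable_exp_generic[of z], of "{k}"] that
      by (auto simp: exp_def)
    then show "exp (- z) * z ^ k / fact k \<le> 1" by (simp add: exp_minus field_simps)
  qed (use that in auto)
  have intw: "integrable ?G (\<lambda>z. exp (- z) * z ^ k / fact k)" for k
  proof (rule G.integrable_const_bound[of _ 1])
    show "AE z in ?G. norm (exp (- z) * z ^ k / fact k) \<le> 1"
      using Gpos by eventually_elim (use wle in auto)
  qed measurable
  \<comment> \<open>The integrated norms are the weights times |q|^k, so the summable
    \<open>?p\<close> justifies exchanging sum and integral.\<close>
  have norm_le: "(LINT z|?G. norm (?f k z)) = ?p k * norm (q ^ k)" for k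
  proof -
    have "(LINT z|?G. norm (?f k z)) = (LINT z|?G. (exp (- z) * z ^ k / fact k) * norm (q ^ k))"
    proof (rule integral_cong_AE)
      show "AE z in ?G. norm (?f k z) = (exp (- z) * z ^ k / fact k) * norm (q ^ k)"
        using Gpos by eventually_elim (simp add: norm_mult norm_divide norm_power)
    qed measurable
    also have "\<dots> = ?p k * norm (q ^ k)" by (simp only: p_eq integral_mult_left_zero)
    finally show ?thesis .
  qed
  have "(\<lambda>k. LINT z|?G. ?f k z) sums (LINT z|?G. (\<Sum>k. ?f k z))"
  proof (rule sums_integral)
    show "integrable ?G (?f k)" for k
      using intw[of k] by (intro integrable_mult_left integrable_of_real)
    show "AE z in ?G. summable (\<lambda>k. norm (?f k z))"
      using Gpos
    proof eventually_elim
      case (elim z)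
      have "summable (\<lambda>k. exp (- z) * (z ^ k /\<^sub>R fact k))"
        by (intro summable_mult summable_exp_generic)
      then show ?case
      proof (rule summable_comparison_test'[where N=0])
        fix k
        show "norm (norm (?f k z)) \<le> exp (- z) * (z ^ k /\<^sub>R fact k)"
          using elim q by (simp add: norm_mult norm_divide norm_power power_le_one mult_left_le field_simps)
      qed
    qed
    show "summable (\<lambda>k. LINT z|?G. norm (?f k z))"
      unfolding norm_le
      by (rule summable_comparison_test'[OF p_sum, of 0]) (use pq p0 in \<open>simp add: norm_mult\<close>)
  qed
  moreover have "(LINT z|?G. ?f k z) = complex_of_real (?p k) * q ^ k" for k
    by (simp only: integral_mult_left_zero integral_complex_of_real p_eq)
  moreover have "(\<Sum>k. ?f k z) = exp (complex_of_real z * (q - 1))" for z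
    using poisson by (rule sums_unique[symmetric])
  ultimately have "(\<lambda>k. complex_of_real (?p k) * q ^ k) sums (LINT z|?G. exp (complex_of_real z * (q - 1)))"
    by simp
  with L show ?thesis by (rule sums_unique2)
qed

text \<open>The generating function at exp (i t / n) yields the characteristic function E exp (V n
  (exp (i t / n) - 1)), and n (exp (i t / n) - 1) tends to i t. Its real part is never positive, so
  the integrands are bounded by 1.\<close>

lemma gen_negbin_weak_conv:
  fixes N :: "nat \<Rightarrow> 's \<Rightarrow> nat"
  assumes M: "prob_space M" and N: "\<And>n. N n \<in> measurable M (count_space UNIV)"
    and P: "\<And>n k. 1 \<le> n \<Longrightarrow> measure M {\<omega> \<in> space M. N n \<omega> = k} = gen_negbin_prob r a (1 / real n powr a) k"
    and r: "0 < r" and a: "a \<noteq> 0"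
  shows "weak_conv_m (\<lambda>n. distr M borel (\<lambda>\<omega>. real (N n \<omega>) / real n))
    (distr (gamma_distr r) borel (\<lambda>x. x powr (1 / a)))"
proof (rule levy_continuity)
  interpret M: prob_space M by fact
  note N [measurable]
  interpret G: prob_space "gamma_distr r" using r by (intro prob_space_gamma_distr) auto
  show "real_distribution (distr M borel (\<lambda>\<omega>. real (N n \<omega>) / real n))" for n
    by (simp add: real_distribution_def real_distribution_axioms_def M.prob_space_distr)
  show "real_distribution (distr (gamma_distr r) borel (\<lambda>x. x powr (1 / a)))"
    by (simp add: real_distribution_def real_distribution_axioms_def G.prob_space_distr)
  fix t
  define h where "h n = \<i> * complex_of_real (t / real n)" for n
  have re: "Re (exp (h n) - 1) \<le> 0" for n by (simp add: h_def Re_exp)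
  have ch: "char (distr M borel (\<lambda>\<omega>. real (N n \<omega>) / real n)) t
    = (LINT x|gamma_distr r. exp (complex_of_real (x powr (1 / a)) * (of_nat n * (exp (h n) - 1))))" if n: "1 \<le> n" for n
  proof -
    have e: "iexp (t * (real k / real n)) = exp (h n) ^ k" for k
      by (subst exp_of_nat_mult[symmetric]) (simp add: h_def mult_ac)
    have "char (distr M borel (\<lambda>\<omega>. real (N n \<omega>) / real n)) t = (LINT \<omega>|M. exp (h n) ^ N n \<omega>)"
      unfolding char_def by (subst integral_distr) (auto simp only: e, measurable)
    also have "\<dots> = (LINT z|gen_gamma_distr r a (1 / real n powr a). exp (complex_of_real z * (exp (h n) - 1)))"
      using n by (intro gen_negbin_pgf M N P r a) (auto simp: h_def simp flip: of_real_divide)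
    also have "\<dots> = (LINT x|gamma_distr r. exp (complex_of_real (x powr (1 / a)) * (of_nat n * (exp (h n) - 1))))"
      unfolding gen_gamma_distr_eq_distr_gamma_scaled[OF r a n]
      by (subst integral_distr) (auto simp: mult_ac)
    finally show ?thesis .
  qed
  have hlim: "(\<lambda>n. of_nat n * (exp (h n) - 1)) \<longlonglongrightarrow> \<i> * complex_of_real t"
  proof -
    have "(\<lambda>n. t / real n) \<longlonglongrightarrow> 0" by real_asymp
    then have "h \<longlonglongrightarrow> 0" unfolding h_def using tendsto_mult[OF tendsto_const[of \<i>] tendsto_of_real] by fastforce
    from tendsto_mult[OF tendsto_const[of "\<i> * complex_of_real t"] exp_minus_one_over_tendsto[OF this]]
    have "(\<lambda>n. \<i> * complex_of_real t * (if h n = 0 then 1 else (exp (h n) - 1) / h n)) \<longlonglongrightarrow> \<i> * complex_of_real t" by simp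
    \<comment> \<open>The two sequences are compared from n = 1 on, where division by n is
      genuine.\<close>
    then show ?thesis
    proof (rule Lim_transform_eventually)
      show "\<forall>\<^sub>F n in sequentially. \<i> * complex_of_real t * (if h n = 0 then 1 else (exp (h n) - 1) / h n) = of_nat n * (exp (h n) - 1)"
        using eventually_ge_at_top[of 1] by eventually_elim (auto simp: h_def)
    qed
  qed
  have "(\<lambda>n. LINT x|gamma_distr r. exp (complex_of_real (x powr (1 / a)) * (of_nat n * (exp (h n) - 1))))
    \<longlonglongrightarrow> (LINT x|gamma_distr r. exp (complex_of_real (x powr (1 / a)) * (\<i> * complex_of_real t)))"
  proof (rule integral_dominated_convergence[where w="\<lambda>_. 1"])
    show "AE x in gamma_distr r. (\<lambda>n. exp (complex_of_real (x powr (1 / a)) * (of_nat n * (exp (h n) - 1))))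
      \<longlonglongrightarrow> exp (complex_of_real (x powr (1 / a)) * (\<i> * complex_of_real t))"
      by (intro AE_I2 tendsto_intros hlim)
    show "AE x in gamma_distr r. norm (exp (complex_of_real (x powr (1 / a)) * (of_nat n * (exp (h n) - 1)))) \<le> 1" for n
    proof (rule AE_I2)
      fix x :: real
      have "Re (complex_of_real (x powr (1 / a)) * (of_nat n * (exp (h n) - 1))) = x powr (1 / a) * (real n * Re (exp (h n) - 1))"
        by simp
      also have "\<dots> \<le> 0" using re[of n] by (intro mult_nonneg_nonpos) auto
      finally show "norm (exp (complex_of_real (x powr (1 / a)) * (of_nat n * (exp (h n) - 1)))) \<le> 1" by simp
    qed
  qed auto
  also have "(LINT x|gamma_distr r. exp (complex_of_real (x powr (1 / a)) * (\<i> * complex_of_real t)))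
    = char (distr (gamma_distr r) borel (\<lambda>x. x powr (1 / a))) t"
    unfolding char_def by (subst integral_distr) (auto simp: mult_ac)
  finally show "(\<lambda>n. char (distr M borel (\<lambda>\<omega>. real (N n \<omega>) / real n)) t)
    \<longlonglongrightarrow> char (distr (gamma_distr r) borel (\<lambda>x. x powr (1 / a))) t"
  proof (rule Lim_transform_eventually)
    show "\<forall>\<^sub>F n in sequentially. (LINT x|gamma_distr r. exp (complex_of_real (x powr (1 / a)) * (of_nat n * (exp (h n) - 1))))
      = char (distr M borel (\<lambda>\<omega>. real (N n \<omega>) / real n)) t"
      using eventually_ge_at_top[of 1] by eventually_elim (use ch in simp)
  qed
qed

section \<open>The limit law under independent random sample sizes\<close>

text \<open>A transfer principle for an arbitrary positive limit V of the relative sample size. With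
  k = N_n one has sqrt n = sqrt k / sqrt (k / n); positivity of V sends k to infinity along almost
  every Skorohod path and keeps the divisor away from 0.\<close>

lemma random_sample_size_weak_conv:
  fixes X :: "nat \<Rightarrow> 's \<Rightarrow> real" and U :: "nat \<Rightarrow> (nat \<Rightarrow> real) \<Rightarrow> real" and N :: "nat \<Rightarrow> 's \<Rightarrow> nat"
  assumes M: "prob_space M"
    and X: "\<And>i. X i \<in> borel_measurable M"
    and U: "\<And>n. U n \<in> borel_measurable (Pi\<^sub>M {..<n} (\<lambda>_. borel))"
    and U_asn: "weak_conv_m
        (\<lambda>n. distr M borel (\<lambda>\<omega>. sqrt (real n) * (U n (\<lambda>i\<in>{..<n}. X i \<omega>) - \<theta>)))
        std_normal_distribution"
    and N: "\<And>n. N n \<in> measurable M (count_space UNIV)"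
    and N_indep: "\<And>n. prob_space.indep_set M
        {N n -` B \<inter> space M | B. B \<in> sets (count_space UNIV)}
        {(\<lambda>\<omega> i. X i \<omega>) -` A \<inter> space M | A. A \<in> sets (Pi\<^sub>M UNIV (\<lambda>_. borel))}"
    and V: "real_distribution V" and V_pos: "AE v in V. 0 < v"
    and NV: "weak_conv_m (\<lambda>n. distr M borel (\<lambda>\<omega>. real (N n \<omega>) / real n)) V"
  shows "weak_conv_m
        (\<lambda>n. distr M borel (\<lambda>\<omega>. sqrt (real n) * (U (N n \<omega>) (\<lambda>i\<in>{..<N n \<omega>}. X i \<omega>) - \<theta>)))
        (distr (std_normal_distribution \<Otimes>\<^sub>M V) borel (\<lambda>(x, v). x * sqrt (1 / v)))"
proof -
  interpret M: prob_space M by fact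
  interpret V: real_distribution V by fact
  note X [measurable] N [measurable]
  let ?C = "count_space (UNIV :: nat set)" and ?P = "Pi\<^sub>M UNIV (\<lambda>_. borel) :: (nat \<Rightarrow> real) measure"
  \<comment> \<open>Regarding the centred statistic as a function of the whole sequence makes the
    randomly indexed one a function of the pair (N, sequence).\<close>
  define u where "u k x = U k (\<lambda>i\<in>{..<k}. x i) - \<theta>" for k x
  have u [measurable]: "u k \<in> borel_measurable ?P" for k
  proof -
    have [measurable]: "(\<lambda>x. restrict x {..<k}) \<in> measurable ?P (Pi\<^sub>M {..<k} (\<lambda>_. borel))"
      by (rule measurable_restrict_subset) auto
    note U [measurable]
    show ?thesis unfolding u_def by measurable
  qed
  define XX where "XX \<omega> = (\<lambda>i. X i \<omega>)" for \<omega>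
  have XX [measurable]: "XX \<in> measurable M ?P"
    unfolding XX_def by (rule measurable_PiM_single') auto
  have pairu: "(\<lambda>p. u (fst p) (snd p)) \<in> borel_measurable (?C \<Otimes>\<^sub>M ?P)"
    by (rule measurable_pair_measure_countable1) auto
  \<comment> \<open>Independence in the form used by Fubini: the joint law of sample size and
    observations is a product.\<close>
  have pair: "distr M ?C (N n) \<Otimes>\<^sub>M distr M ?P XX = distr M (?C \<Otimes>\<^sub>M ?P) (\<lambda>\<omega>. (N n \<omega>, XX \<omega>))" for n
  proof -
    interpret A: prob_space "distr M ?C (N n)" by (rule M.prob_space_distr) measurable
    interpret B: prob_space "distr M ?P XX" by (rule M.prob_space_distr) measurable
    show ?thesis
    proof (rule pair_measure_eqI)
      fix A B assume "A \<in> sets (distr M ?C (N n))" "B \<in> sets (distr M ?P XX)"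
      then have AB: "A \<in> sets ?C" "B \<in> sets ?P" by auto
      have "M.prob ((N n -` A \<inter> space M) \<inter> (XX -` B \<inter> space M))
        = M.prob (N n -` A \<inter> space M) * M.prob (XX -` B \<inter> space M)"
        using N_indep[of n] AB unfolding XX_def[abs_def] by (intro M.indep_setD) auto
      moreover have "(\<lambda>\<omega>. (N n \<omega>, XX \<omega>)) -` (A \<times> B) \<inter> space M = (N n -` A \<inter> space M) \<inter> (XX -` B \<inter> space M)"
        by auto
      ultimately show "emeasure (distr M ?C (N n)) A * emeasure (distr M ?P XX) B
        = emeasure (distr M (?C \<Otimes>\<^sub>M ?P) (\<lambda>\<omega>. (N n \<omega>, XX \<omega>))) (A \<times> B)"
        using AB by (simp add: emeasure_distr M.emeasure_eq_measure ennreal_mult)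
    next
      show "sets (distr M ?C (N n) \<Otimes>\<^sub>M distr M ?P XX) = sets (distr M (?C \<Otimes>\<^sub>M ?P) (\<lambda>\<omega>. (N n \<omega>, XX \<omega>)))"
        unfolding sets_distr by (rule sets_pair_measure_cong) simp_all
    qed (rule A.sigma_finite_measure_axioms B.sigma_finite_measure_axioms)+
  qed
  define T where "T n \<omega> = sqrt (real n) * u (N n \<omega>) (XX \<omega>)" for n \<omega>
  have T [measurable]: "T n \<in> borel_measurable M" for n
  proof -
    have "(\<lambda>\<omega>. u (fst (N n \<omega>, XX \<omega>)) (snd (N n \<omega>, XX \<omega>))) \<in> borel_measurable M"
      by (rule measurable_compose[OF _ pairu]) measurable
    then show ?thesis unfolding T_def by simp
  qed
  define \<mu> where "\<mu> k = distr M borel (\<lambda>\<omega>. sqrt (real k) * u k (XX \<omega>))" for k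
  have \<mu>: "real_distribution (\<mu> k)" for k
    unfolding \<mu>_def by (simp add: real_distribution_def real_distribution_axioms_def M.prob_space_distr)
  have \<mu>_conv: "weak_conv_m \<mu> std_normal_distribution"
    using U_asn by (simp add: \<mu>_def[abs_def] u_def XX_def)
  have "weak_conv_m (\<lambda>n. distr M borel (T n)) (distr (std_normal_distribution \<Otimes>\<^sub>M V) borel (\<lambda>(x, v). x * sqrt (1 / v)))"
  proof (rule levy_continuity)
    show "real_distribution (distr M borel (T n))" for n
      by (simp add: real_distribution_def real_distribution_axioms_def M.prob_space_distr)
    show "real_distribution (distr (std_normal_distribution \<Otimes>\<^sub>M V) borel (\<lambda>(x, v). x * sqrt (1 / v)))"
      by (intro real_distribution_distr_pair V.prob_space_axioms)
         (use real_dist_normal_dist in \<open>auto simp: real_distribution_def\<close>)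
    fix t
    \<comment> \<open>\<open>H n k\<close> is the characteristic function given N n = k, with the
      norming sqrt n retained.\<close>
    define H where "H n k = (LINT \<omega>|M. iexp (t * (sqrt (real n) * u k (XX \<omega>))))" for n k
    have H_le: "norm (H n k) \<le> 1" for n k
    proof -
      have "norm (H n k) \<le> (LINT \<omega>|M. norm (iexp (t * (sqrt (real n) * u k (XX \<omega>)))))"
        unfolding H_def by (rule integral_norm_bound)
      also have "\<dots> = 1" by (simp add: M.prob_space flip: of_real_mult)
      finally show ?thesis .
    qed
    \<comment> \<open>Both n and k are taken positive, as the rescaling divides by sqrt (k /
      n).\<close>
    have H_eq: "H n k = char (\<mu> k) (t / sqrt (real k / real n))" if "1 \<le> n" "1 \<le> k" for n k
    proof -
      have "t / sqrt (real k / real n) * (sqrt (real k) * x) = t * (sqrt (real n) * x)" for x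
        using that by (simp add: real_sqrt_divide)
      then show ?thesis unfolding H_def \<mu>_def char_def by (subst integral_distr) auto
    qed
    have ch: "char (distr M borel (T n)) t = (LINT \<omega>|M. H n (N n \<omega>))" for n
    proof -
      interpret A: prob_space "distr M ?C (N n)" by (rule M.prob_space_distr) measurable
      interpret B: prob_space "distr M ?P XX" by (rule M.prob_space_distr) measurable
      interpret AB: pair_prob_space "distr M ?C (N n)" "distr M ?P XX" ..
      let ?g = "\<lambda>k x. iexp (t * (sqrt (real n) * u k x))"
      have g: "(\<lambda>(k, x). ?g k x) \<in> borel_measurable (?C \<Otimes>\<^sub>M ?P)"
        using pairu by (simp add: split_beta')
      have int: "integrable (distr M ?C (N n) \<Otimes>\<^sub>M distr M ?P XX) (\<lambda>(k, x). ?g k x)"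
        by (rule AB.integrable_const_bound[of _ 1])
           (use g in \<open>auto simp: split_beta' simp flip: of_real_mult cong: measurable_cong_sets\<close>)
      have "char (distr M borel (T n)) t = (LINT \<omega>|M. (case (N n \<omega>, XX \<omega>) of (k, x) \<Rightarrow> ?g k x))"
        unfolding char_def T_def[symmetric] by (subst integral_distr) (auto simp: T_def)
      also have "\<dots> = (LINT p|(distr M ?C (N n) \<Otimes>\<^sub>M distr M ?P XX). (case p of (k, x) \<Rightarrow> ?g k x))"
        unfolding pair using g by (subst integral_distr) auto
      also have "\<dots> = (LINT k|distr M ?C (N n). (LINT x|distr M ?P XX. ?g k x))"
        using AB.integral_fst'[OF int] by simp
      also have "\<dots> = (LINT \<omega>|M. H n (N n \<omega>))"
        unfolding H_def by (simp add: integral_distr)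
      finally show ?thesis .
    qed
    \<comment> \<open>Rounding recovers \<open>N n\<close> from \<open>N n / n\<close> and extends the conditional characteristic function to
      all reals, as the Skorohod variables need not be multiples of \<open>1 / n\<close>.\<close>
    define F where "F n x = H n (nat \<lfloor>real n * x + 1 / 2\<rfloor>)" for n and x :: real
    have F [measurable]: "F n \<in> borel_measurable borel" for n
    proof -
      have "(\<lambda>x::real. nat \<lfloor>real n * x + 1 / 2\<rfloor>) \<in> measurable borel ?C" by measurable
      from measurable_compose[OF this, of "H n" borel] show ?thesis by (simp add: F_def[abs_def])
    qed
    let ?V = "\<lambda>n. distr M borel (\<lambda>\<omega>. real (N n \<omega>) / real n)"
    have Vn: "real_distribution (?V n)" for n
      by (simp add: real_distribution_def real_distribution_axioms_def M.prob_space_distr)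
    obtain \<Omega> :: "real measure" and Y_seq Y where \<Omega>: "prob_space \<Omega>"
      and [measurable]: "\<And>n. Y_seq n \<in> borel_measurable \<Omega>" "Y \<in> borel_measurable \<Omega>"
      and d: "\<And>n. distr \<Omega> borel (Y_seq n) = ?V n" "distr \<Omega> borel Y = V"
      and lim: "\<And>x. x \<in> space \<Omega> \<Longrightarrow> (\<lambda>n. Y_seq n x) \<longlonglongrightarrow> Y x"
      using Skorohod_representation[OF Vn V NV] by metis
    interpret \<Omega>: prob_space \<Omega> by fact
    have chF: "char (distr M borel (T n)) t = (LINT x|\<Omega>. F n (Y_seq n x))" if "1 \<le> n" for n
    proof -
      have FH: "F n (real k / real n) = H n k" for k
      proof -
        have "\<lfloor>real k + 1 / 2\<rfloor> = int k" by (simp add: floor_eq_iff)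
        then show ?thesis using that by (simp add: F_def)
      qed
      have "(LINT x|\<Omega>. F n (Y_seq n x)) = (LINT y|?V n. F n y)"
        unfolding d(1)[symmetric] by (subst integral_distr) auto
      also have "\<dots> = (LINT \<omega>|M. F n (real (N n \<omega>) / real n))" by (subst integral_distr) auto
      finally show ?thesis by (simp add: ch FH)
    qed
    \<comment> \<open>The deterministic core, applied below to almost every Skorohod path.\<close>
    have pw: "(\<lambda>n. F n (y n)) \<longlonglongrightarrow> char std_normal_distribution (t * sqrt (1 / y0))"
      if y: "y \<longlonglongrightarrow> y0" and y0: "0 < y0" for y y0
    proof -
      define k where "k n = nat \<lfloor>real n * y n + 1 / 2\<rfloor>" for n
      \<comment> \<open>Eventually \<open>y n\<close> is positive, so \<open>nat\<close> does not
        truncate and \<open>k n\<close> stays within 1/2 of n times \<open>y n\<close>.\<close>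
      have ev: "\<forall>\<^sub>F n in sequentially. y0 / 2 < y n" using y y0 by (intro order_tendstoD) auto
      have kn: "(\<lambda>n. real (k n) / real n) \<longlonglongrightarrow> y0"
      proof (rule tendsto_sandwich)
        have "(\<lambda>n. 1 / (2 * real n)) \<longlonglongrightarrow> 0" by real_asymp
        with y show "(\<lambda>n. y n - 1 / (2 * real n)) \<longlonglongrightarrow> y0" "(\<lambda>n. y n + 1 / (2 * real n)) \<longlonglongrightarrow> y0"
          using tendsto_diff[OF y] tendsto_add[OF y] by fastforce+
        have b: "y n - 1 / (2 * real n) \<le> real (k n) / real n \<and> real (k n) / real n \<le> y n + 1 / (2 * real n)"
          if "y0 / 2 < y n" "1 \<le> n" for n
        proof -
          have nn: "0 < real n" using that by simp
          have "0 \<le> real n * y n" using that y0 by (intro mult_nonneg_nonneg) auto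
          then have "real (k n) = of_int \<lfloor>real n * y n + 1 / 2\<rfloor>" unfolding k_def by (simp add: zero_le_floor)
          then have "real n * y n - 1 / 2 \<le> real (k n)" "real (k n) \<le> real n * y n + 1 / 2" by linarith+
          then have "(real n * y n - 1 / 2) / real n \<le> real (k n) / real n"
            "real (k n) / real n \<le> (real n * y n + 1 / 2) / real n"
            using nn by (auto intro: divide_right_mono)
          then show ?thesis using nn by (simp add: diff_divide_distrib add_divide_distrib)
        qed
        show "\<forall>\<^sub>F n in sequentially. y n - 1 / (2 * real n) \<le> real (k n) / real n"
          using ev eventually_ge_at_top[of 1] by eventually_elim (use b in blast)
        show "\<forall>\<^sub>F n in sequentially. real (k n) / real n \<le> y n + 1 / (2 * real n)"
          using ev eventually_ge_at_top[of 1] by eventually_elim (use b in blast)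
      qed
      \<comment> \<open>The ratio \<open>k n\<close> / n has a positive limit, hence
        \<open>k n\<close> itself tends to infinity.\<close>
      have "filterlim (\<lambda>n. real (k n) / real n * real n) at_top sequentially"
        by (rule filterlim_tendsto_pos_mult_at_top[OF kn y0 filterlim_real_sequentially])
      moreover have "\<forall>\<^sub>F n in sequentially. real (k n) / real n * real n = real (k n)"
        using eventually_ge_at_top[of 1] by eventually_elim simp
      ultimately have "filterlim (\<lambda>n. real (k n)) at_top sequentially"
        by (simp cong: filterlim_cong)
      then have kinf: "filterlim k at_top sequentially"
        by (simp add: filterlim_sequentially_iff_filterlim_real)
      have "(\<lambda>n. char (\<mu> (k n)) (t / sqrt (real (k n) / real n))) \<longlonglongrightarrow> char std_normal_distribution (t / sqrt y0)"
        using y0 by (intro weak_conv_char_continuously[OF \<mu> real_dist_normal_dist \<mu>_conv kinf] tendsto_intros kn) auto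
      then have "(\<lambda>n. F n (y n)) \<longlonglongrightarrow> char std_normal_distribution (t / sqrt y0)"
      proof (rule Lim_transform_eventually)
        have "\<forall>\<^sub>F n in sequentially. 1 \<le> k n" using kinf by (simp add: filterlim_at_top)
        then show "\<forall>\<^sub>F n in sequentially. char (\<mu> (k n)) (t / sqrt (real (k n) / real n)) = F n (y n)"
          using eventually_ge_at_top[of 1] by eventually_elim (simp add: F_def H_eq k_def)
      qed
      then show ?thesis by (simp add: real_sqrt_divide)
    qed
    have "(\<lambda>n. LINT x|\<Omega>. F n (Y_seq n x)) \<longlonglongrightarrow> (LINT x|\<Omega>. char std_normal_distribution (t * sqrt (1 / Y x)))"
    proof (rule integral_dominated_convergence[where w="\<lambda>_. 1"])
      have "AE x in \<Omega>. 0 < Y x"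
        using V_pos unfolding d(2)[symmetric] by (subst (asm) AE_distr_iff) auto
      then show "AE x in \<Omega>. (\<lambda>n. F n (Y_seq n x)) \<longlonglongrightarrow> char std_normal_distribution (t * sqrt (1 / Y x))"
        using AE_space by eventually_elim (auto intro: pw lim)
      show "AE x in \<Omega>. norm (F n (Y_seq n x)) \<le> 1" for n
        by (simp add: F_def H_le)
    qed (auto simp: char_std_normal_distribution)
    also have "(LINT x|\<Omega>. char std_normal_distribution (t * sqrt (1 / Y x)))
      = (LINT v|V. char std_normal_distribution (t * sqrt (1 / v)))"
      unfolding d(2)[symmetric] by (subst integral_distr) (auto simp: char_std_normal_distribution)
    also have "\<dots> = char (distr (std_normal_distribution \<Otimes>\<^sub>M V) borel (\<lambda>(x, v). x * sqrt (1 / v))) t"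
      by (rule char_distr_scale_mixture[symmetric, OF real_dist_normal_dist V.prob_space_axioms]) measurable
    finally show "(\<lambda>n. char (distr M borel (T n)) t)
      \<longlonglongrightarrow> char (distr (std_normal_distribution \<Otimes>\<^sub>M V) borel (\<lambda>(x, v). x * sqrt (1 / v))) t"
    proof (rule Lim_transform_eventually)
      show "\<forall>\<^sub>F n in sequentially. (LINT x|\<Omega>. F n (Y_seq n x)) = char (distr M borel (T n)) t"
        using eventually_ge_at_top[of 1] by eventually_elim (use chF in simp)
    qed
  qed
  then show ?thesis by (simp add: T_def[abs_def] u_def XX_def)
qed

text \<open>If V = G^(1 / a), then 1 / V = G^(- 1 / a) has the generalized gamma law with exponent
  -a: dividing by the relative sample size causes the sign change. The two mixtures are compared
  through their characteristic functions.\<close>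

lemma distr_normal_gen_gamma_eq:
  assumes r: "0 < r" and a: "a \<noteq> 0"
  shows "distr (std_normal_distribution \<Otimes>\<^sub>M distr (gamma_distr r) borel (\<lambda>x. x powr (1 / a))) borel
      (\<lambda>(x, v). x * sqrt (1 / v))
    = distr (std_normal_distribution \<Otimes>\<^sub>M gen_gamma_distr r (- a) 1) borel (\<lambda>(x, g). x * sqrt g)"
    (is "?L = ?R")
proof -
  interpret G: prob_space "gamma_distr r" using r by (intro prob_space_gamma_distr) auto
  have gg: "gen_gamma_distr r (- a) 1 = distr (gamma_distr r) borel (\<lambda>x. x powr (- 1 / a))"
    using gen_gamma_distr_eq_distr_gamma[of r "- a" 1] r a by simp
  let ?D1 = "distr (gamma_distr r) borel (\<lambda>x. x powr (1 / a))"
  let ?D2 = "distr (gamma_distr r) borel (\<lambda>x. x powr (- 1 / a))"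
  interpret D1: prob_space ?D1 by (intro G.prob_space_distr) measurable
  interpret D2: prob_space ?D2 by (intro G.prob_space_distr) measurable
  have N: "prob_space std_normal_distribution" using real_dist_normal_dist by (simp add: real_distribution_def)
  have "?L = distr (std_normal_distribution \<Otimes>\<^sub>M ?D2) borel (\<lambda>(x, g). x * sqrt g)"
  proof (rule Levy_uniqueness)
    show "real_distribution ?L" "real_distribution (distr (std_normal_distribution \<Otimes>\<^sub>M ?D2) borel (\<lambda>(x, g). x * sqrt g))"
      by (intro real_distribution_distr_pair N D1.prob_space_axioms D2.prob_space_axioms; measurable)+
    show "char ?L = char (distr (std_normal_distribution \<Otimes>\<^sub>M ?D2) borel (\<lambda>(x, g). x * sqrt g))"
    proof
      fix t
      have "char ?L t = (LINT v|?D1. char std_normal_distribution (t * sqrt (1 / v)))"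
        by (rule char_distr_scale_mixture[OF real_dist_normal_dist D1.prob_space_axioms]) measurable
      also have "\<dots> = (LINT x|gamma_distr r. char std_normal_distribution (t * sqrt (x powr (- 1 / a))))"
        by (subst integral_distr) (auto simp: char_std_normal_distribution powr_minus_divide)
      also have "\<dots> = (LINT g|?D2. char std_normal_distribution (t * sqrt g))"
        by (subst integral_distr) (auto simp: char_std_normal_distribution)
      also have "\<dots> = char (distr (std_normal_distribution \<Otimes>\<^sub>M ?D2) borel (\<lambda>(x, g). x * sqrt g)) t"
        by (rule char_distr_scale_mixture[symmetric, OF real_dist_normal_dist D2.prob_space_axioms]) measurable
      finally show "char ?L t = char (distr (std_normal_distribution \<Otimes>\<^sub>M ?D2) borel (\<lambda>(x, g). x * sqrt g)) t" .
    qed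
  qed
  then show ?thesis unfolding gg .
qed

theorem theorem9:
  fixes M :: "'s measure"
    and X :: "nat \<Rightarrow> 's \<Rightarrow> real"
    and U :: "nat \<Rightarrow> (nat \<Rightarrow> real) \<Rightarrow> real"
    and N :: "nat \<Rightarrow> 's \<Rightarrow> nat"
    and \<theta> r \<alpha> :: real
  assumes M: "prob_space M"
    and X_indep: "prob_space.indep_vars M (\<lambda>_. borel) X UNIV"
    and X_ident: "\<And>i. distr M borel (X i) = distr M borel (X 0)"
    and U_meas: "\<And>n. U n \<in> borel_measurable (Pi\<^sub>M {..<n} (\<lambda>_. borel))"
    and U_asn: "weak_conv_m
        (\<lambda>n. distr M borel (\<lambda>\<omega>. sqrt (real n) * (U n (\<lambda>i\<in>{..<n}. X i \<omega>) - \<theta>)))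
        std_normal_distribution"
    and r_pos: "0 < r" and \<alpha>_nz: "\<alpha> \<noteq> 0"
    and N_meas: "\<And>n. N n \<in> measurable M (count_space UNIV)"
    and N_distr: "\<And>n k. 1 \<le> n \<Longrightarrow>
        measure M {\<omega> \<in> space M. N n \<omega> = k} = gen_negbin_prob r \<alpha> (1 / real n powr \<alpha>) k"
    and N_indep: "\<And>n. prob_space.indep_set M
        {N n -` B \<inter> space M | B. B \<in> sets (count_space UNIV)}
        {(\<lambda>\<omega> i. X i \<omega>) -` A \<inter> space M | A. A \<in> sets (Pi\<^sub>M UNIV (\<lambda>_. borel))}"
  shows "weak_conv_m
        (\<lambda>n. distr M borel
           (\<lambda>\<omega>. sqrt (real n) * (U (N n \<omega>) (\<lambda>i\<in>{..<N n \<omega>}. X i \<omega>) - \<theta>)))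
        (distr (std_normal_distribution \<Otimes>\<^sub>M gen_gamma_distr r (- \<alpha>) 1) borel
           (\<lambda>(x, g). x * sqrt g))
    \<and> (r \<le> 1 \<and> 0 < \<alpha> \<and> \<alpha> \<le> 1 \<longrightarrow>
        (\<forall>S1 S2. real_distribution S1 \<and> char S1 = stable_os_char \<alpha> \<and>
                 real_distribution S2 \<and> char S2 = stable_sym_char \<alpha> \<longrightarrow>
           distr (std_normal_distribution \<Otimes>\<^sub>M gen_gamma_distr r (- \<alpha>) 1) borel
             (\<lambda>(x, g). x * sqrt g)
           = distr (std_normal_distribution \<Otimes>\<^sub>M (S1 \<Otimes>\<^sub>M (Z_distr r \<Otimes>\<^sub>M exp1_distr))) borel
             (\<lambda>(x, s, z, w). x * sqrt (s * z powr (1 / \<alpha>) / w))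
         \<and> distr (std_normal_distribution \<Otimes>\<^sub>M (S1 \<Otimes>\<^sub>M (Z_distr r \<Otimes>\<^sub>M exp1_distr))) borel
             (\<lambda>(x, s, z, w). x * sqrt (s * z powr (1 / \<alpha>) / w))
           = distr (S2 \<Otimes>\<^sub>M (Z_distr r \<Otimes>\<^sub>M exp1_distr)) borel
             (\<lambda>(s, z, w). s * sqrt (z powr (1 / \<alpha>) / (2 * w)))))"
proof (intro conjI impI allI)
  interpret M: prob_space M by fact
  have X_meas: "X i \<in> borel_measurable M" for i
    using X_indep by (auto simp: M.indep_vars_def)
  interpret G: prob_space "gamma_distr r" using r_pos by (intro prob_space_gamma_distr) auto
  \<comment> \<open>The limit law of the relative sample size N_n / n.\<close>
  let ?V = "distr (gamma_distr r) borel (\<lambda>x. x powr (1 / \<alpha>))"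
  have "weak_conv_m
        (\<lambda>n. distr M borel (\<lambda>\<omega>. sqrt (real n) * (U (N n \<omega>) (\<lambda>i\<in>{..<N n \<omega>}. X i \<omega>) - \<theta>)))
        (distr (std_normal_distribution \<Otimes>\<^sub>M ?V) borel (\<lambda>(x, v). x * sqrt (1 / v)))"
  proof (rule random_sample_size_weak_conv[OF M X_meas U_meas U_asn N_meas N_indep])
    show "real_distribution ?V"
      by (simp add: real_distribution_def real_distribution_axioms_def G.prob_space_distr)
    have "AE x in gamma_distr r. 0 < x powr (1 / \<alpha>)"
      using AE_gamma_distr_pos[OF r_pos] by eventually_elim simp
    then show "AE v in ?V. 0 < v" by (subst AE_distr_iff) auto
    show "weak_conv_m (\<lambda>n. distr M borel (\<lambda>\<omega>. real (N n \<omega>) / real n)) ?V"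
      by (rule gen_negbin_weak_conv[OF M N_meas N_distr r_pos \<alpha>_nz])
  qed
  then show "weak_conv_m
        (\<lambda>n. distr M borel
           (\<lambda>\<omega>. sqrt (real n) * (U (N n \<omega>) (\<lambda>i\<in>{..<N n \<omega>}. X i \<omega>) - \<theta>)))
        (distr (std_normal_distribution \<Otimes>\<^sub>M gen_gamma_distr r (- \<alpha>) 1) borel
           (\<lambda>(x, g). x * sqrt g))"
    unfolding distr_normal_gen_gamma_eq[OF r_pos \<alpha>_nz] .
qed (use r_pos in \<open>auto intro: normal_gen_gamma_representations\<close>)

end
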